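(* Let $n\ge 23$ and let $c^*=\frac{3n}{4}+\frac{21}{64}$. Define $$f_e(c)=c^3+(2n^2-2n-3)c^2+(-3n^3+3n-1)c+(6n^3-5n^2+2n)+\frac{-3n^3+3n^2}{c},$$ $$f_o(c)=c^3+(2n^2-2n-3)c^2+(-3n^3+6n-1)c+(6n^3-5n^2-4n+3)+\frac{-3n^3+3n^2+3n-3}{c}.$$ Consider the minimum of $\mathcal{K}(G)-\mathcal{K}(T)$ over all trees $T$ on $n$ vertices and all graphs $G$ obtained from $T$ by adding an edge between two non-adjacent vertices. If $n\equiv 0,1,6,7 \pmod 8$, this minimum value equals $$\frac{1}{6n(n-1)}\min\{f_e(\lfloor c^*\rfloor),f_e(\lfloor c^*\rfloor+2),f_o(\lceil c^*\rceil),f_o(\lceil c^*\rceil-2)\}.$$ If $n\equiv 2,3,4,5\pmod 8$, this minimum value equals $$\frac{1}{6n(n-1)}\min\{f_o(\lfloor c^*\rfloor),f_o(\lfloor c^*\rfloor+2),f_e(\lceil c^*\rceil),f_e(\lceil c^*\rceil-2)\}.$$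
   Context: Kemeny's constant: for a connected graph $H$ with adjacency matrix $A$ and diagonal degree matrix $\Delta$, consider the random walk with transition matrix $\Delta^{-1}A$, its stationary distribution $w=(w_k)$ and mean first passage times $m_{j,k}$; then $\mathcal{K}(H)=\sum_{k\neq j} m_{j,k}w_k$, which is independent of $j$. *)

theory Defs
  imports Complex_Main
begin

definition simple_graph :: "nat \<Rightarrow> (nat \<Rightarrow> nat \<Rightarrow> bool) \<Rightarrow> bool" where
  "simple_graph n E \<longleftrightarrow> (\<forall>i j. E i j \<longrightarrow> i < n \<and> j < n \<and> i \<noteq> j \<and> E j i)"

definition connected_graph :: "nat \<Rightarrow> (nat \<Rightarrow> nat \<Rightarrow> bool) \<Rightarrow> bool" where
  "connected_graph n E \<longleftrightarrow> n \<ge> 1 \<and> (\<forall>i<n. \<forall>j<n. E\<^sup>*\<^sup>* i j)"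

definition num_edges :: "nat \<Rightarrow> (nat \<Rightarrow> nat \<Rightarrow> bool) \<Rightarrow> nat" where
  "num_edges n E = card {(i, j). i < j \<and> j < n \<and> E i j}"

definition is_tree :: "nat \<Rightarrow> (nat \<Rightarrow> nat \<Rightarrow> bool) \<Rightarrow> bool" where
  "is_tree n E \<longleftrightarrow> simple_graph n E \<and> connected_graph n E \<and> num_edges n E = n - 1"

definition add_edge :: "(nat \<Rightarrow> nat \<Rightarrow> bool) \<Rightarrow> nat \<Rightarrow> nat \<Rightarrow> nat \<Rightarrow> nat \<Rightarrow> bool" where
  "add_edge E u v = (\<lambda>i j. E i j \<or> (i = u \<and> j = v) \<or> (i = v \<and> j = u))"

definition degree :: "nat \<Rightarrow> (nat \<Rightarrow> nat \<Rightarrow> bool) \<Rightarrow> nat \<Rightarrow> nat" where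
  "degree n E i = card {j. j < n \<and> E i j}"

definition trans :: "nat \<Rightarrow> (nat \<Rightarrow> nat \<Rightarrow> bool) \<Rightarrow> nat \<Rightarrow> nat \<Rightarrow> real" where
  "trans n E i j = (if E i j then 1 / real (degree n E i) else 0)"

definition stat_dist :: "nat \<Rightarrow> (nat \<Rightarrow> nat \<Rightarrow> bool) \<Rightarrow> nat \<Rightarrow> real" where
  "stat_dist n E k = real (degree n E k) / (\<Sum>i<n. real (degree n E i))"

text \<open>first_passage n E t j k = probability that the walk started at j
  visits k for the first time at step t+1.\<close>
fun first_passage :: "nat \<Rightarrow> (nat \<Rightarrow> nat \<Rightarrow> bool) \<Rightarrow> nat \<Rightarrow> nat \<Rightarrow> nat \<Rightarrow> real" where
  "first_passage n E 0 j k = trans n E j k"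
| "first_passage n E (Suc t) j k =
     (\<Sum>l\<in>{0..<n} - {k}. trans n E j l * first_passage n E t l k)"

definition mfpt :: "nat \<Rightarrow> (nat \<Rightarrow> nat \<Rightarrow> bool) \<Rightarrow> nat \<Rightarrow> nat \<Rightarrow> real" where
  "mfpt n E j k = (\<Sum>t. real (t + 1) * first_passage n E t j k)"

text \<open>Kemeny's constant, K(H) = sum_{k \<noteq> j} m_{j,k} w_k, taken with j = 0
  (the value is independent of j).\<close>
definition kemeny :: "nat \<Rightarrow> (nat \<Rightarrow> nat \<Rightarrow> bool) \<Rightarrow> real" where
  "kemeny n E = (\<Sum>k\<in>{0..<n} - {0}. mfpt n E 0 k * stat_dist n E k)"

definition f_e :: "nat \<Rightarrow> real \<Rightarrow> real" where
  "f_e n c = (let m = real n in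
     c^3 + (2*m^2 - 2*m - 3)*c^2 + (-3*m^3 + 3*m - 1)*c + (6*m^3 - 5*m^2 + 2*m)
     + (-3*m^3 + 3*m^2) / c)"

definition f_o :: "nat \<Rightarrow> real \<Rightarrow> real" where
  "f_o n c = (let m = real n in
     c^3 + (2*m^2 - 2*m - 3)*c^2 + (-3*m^3 + 6*m - 1)*c + (6*m^3 - 5*m^2 - 4*m + 3)
     + (-3*m^3 + 3*m^2 + 3*m - 3) / c)"

definition c_star :: "nat \<Rightarrow> real" where
  "c_star n = 3 * real n / 4 + 21 / 64"

definition kemeny_diffs :: "nat \<Rightarrow> real set" where
  "kemeny_diffs n = {kemeny n (add_edge T u v) - kemeny n T | T u v.
      is_tree n T \<and> u < n \<and> v < n \<and> u \<noteq> v \<and> \<not> T u v}"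

end

theory Submission
  imports Defs
begin

text \<open>
  Kemeny's constant of a graph with \<open>m\<close> edges is \<open>\<Sum> d\<^sub>x d\<^sub>y r(x,y) / 4m\<close>, where \<open>r\<close> is the effective
  resistance.  For a tree \<open>r\<close> is the distance.  If the new edge closes a cycle of length \<open>c\<close>, let \<open>b(x)\<close>
  be the position on the tree path between its ends at which \<open>x\<close> is attached, and \<open>h(x)\<close> the distance of
  \<open>x\<close> from the path; then \<open>r(x,y)\<close> drops from the distance by exactly \<open>(b(x) - b(y))\<^sup>2 / c\<close>, and the
  degree weights of the new graph give every function of \<open>b\<close> twice its unweighted sum.  Hence the change
  of Kemeny's constant is an affine function of \<open>\<Sum> h(x)\<close>, \<open>\<Sum> dist(x,y)\<close> and \<open>\<Sum> (b(x) - b(y))\<^sup>2\<close>.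
  The bound \<open>dist(x,y) \<le> h(x) + h(y) + |b(x) - b(y)|\<close> for \<open>x \<noteq> y\<close> eliminates \<open>h\<close> exactly, with equality
  when all \<open>h(x) \<le> 1\<close>.  Both \<open>\<Sum> |b(x) - b(y)|\<close> and \<open>\<Sum> (b(x) - b(y))\<^sup>2\<close> are largest when the \<open>n - c\<close>
  remaining vertices are split evenly between the two ends of the path, which gives \<open>f_e(c)\<close> or \<open>f_o(c)\<close>
  according to the parity of \<open>n - c\<close>.  Finally both functions, along steps of length \<open>2\<close>, decrease
  up to about \<open>c\<^sup>*\<close> and increase afterwards.
\<close>

section \<open>Mean first passage times and resistances\<close>

definition adj :: "(nat \<Rightarrow> nat \<Rightarrow> bool) \<Rightarrow> nat \<Rightarrow> nat \<Rightarrow> real" where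
  "adj E i j = of_bool (E i j)"

definition lap :: "nat \<Rightarrow> (nat \<Rightarrow> nat \<Rightarrow> bool) \<Rightarrow> (nat \<Rightarrow> real) \<Rightarrow> nat \<Rightarrow> real" where
  "lap n E f j = (\<Sum>l<n. adj E j l * (f j - f l))"

text \<open>The transition operator of the walk that dies on stepping to \<open>k\<close>.\<close>

definition killed :: "nat \<Rightarrow> (nat \<Rightarrow> nat \<Rightarrow> bool) \<Rightarrow> nat \<Rightarrow> (nat \<Rightarrow> real) \<Rightarrow> nat \<Rightarrow> real" where
  "killed n E k g j = (\<Sum>l\<in>{0..<n} - {k}. trans n E j l * g l)"

lemma degree_adj: "real (degree n E i) = (\<Sum>l<n. adj E i l)"
proof -
  have "(\<Sum>l<n. adj E i l) = real (card ({..<n} \<inter> {l. E i l}))"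
    unfolding adj_def by (simp add: sum_of_bool_eq)
  also have "{..<n} \<inter> {l. E i l} = {j. j < n \<and> E i j}" by auto
  finally show ?thesis by (simp add: degree_def)
qed

lemma trans_adj: "trans n E i j = adj E i j / real (degree n E i)"
  by (simp add: trans_def adj_def)

lemma trans_nonneg: "0 \<le> trans n E i j"
  by (simp add: trans_def)

lemma trans_row_sum:
  assumes "degree n E j > 0"
  shows "(\<Sum>l<n. trans n E j l) = 1"
proof -
  have "(\<Sum>l<n. trans n E j l) = (\<Sum>l<n. adj E j l) / real (degree n E j)"
    unfolding trans_adj by (rule sum_divide_distrib [symmetric])
  then show ?thesis using assms by (simp add: degree_adj[symmetric])
qed

lemma killed_mono:
  assumes "\<And>l. l < n \<Longrightarrow> l \<noteq> k \<Longrightarrow> f l \<le> g l"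
  shows "killed n E k f j \<le> killed n E k g j"
  unfolding killed_def by (intro sum_mono mult_left_mono assms trans_nonneg) auto

lemma killed_cmult: "killed n E k (\<lambda>l. a * f l) j = a * killed n E k f j"
  by (simp add: killed_def sum_distrib_left algebra_simps)

lemma killed_one:
  assumes "degree n E j > 0" "k < n"
  shows "killed n E k (\<lambda>_. 1) j = 1 - trans n E j k"
proof -
  have "(\<Sum>l<n. trans n E j l) = trans n E j k + (\<Sum>l\<in>{0..<n} - {k}. trans n E j l)"
    using assms by (simp add: lessThan_atLeast0 sum.remove)
  then show ?thesis using trans_row_sum[OF assms(1)] by (simp add: killed_def)
qed

lemma killed_power_nonneg:
  assumes "\<And>l. 0 \<le> g l"
  shows "0 \<le> ((killed n E k ^^ t) g) j"
proof (induction t arbitrary: j)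
  case 0 then show ?case using assms by simp
next
  case (Suc t) then show ?case
    by (simp add: killed_def) (intro sum_nonneg mult_nonneg_nonneg trans_nonneg, auto)
qed

text \<open>Iterating \<open>killed n E k\<close> on the constant 1 gives the probability of not having visited \<open>k\<close> yet.\<close>

lemma first_passage_killed:
  assumes "\<And>j. j < n \<Longrightarrow> degree n E j > 0" "k < n" "j < n"
  shows "first_passage n E t j k =
    (killed n E k ^^ t) (\<lambda>_. 1) j - (killed n E k ^^ Suc t) (\<lambda>_. 1) j"
  using assms(3)
proof (induction t arbitrary: j)
  case 0
  then show ?case using assms killed_one[of n E j k] by simp
next
  case (Suc t)
  have "first_passage n E (Suc t) j k =
      (\<Sum>l\<in>{0..<n} - {k}. trans n E j l *
        ((killed n E k ^^ t) (\<lambda>_. 1) l - (killed n E k ^^ Suc t) (\<lambda>_. 1) l))"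
    unfolding first_passage.simps using Suc by (intro sum.cong refl) (metis DiffD1 atLeastLessThan_iff)
  also have "\<dots> = (killed n E k ^^ Suc t) (\<lambda>_. 1) j - (killed n E k ^^ Suc (Suc t)) (\<lambda>_. 1) j"
    by (simp add: killed_def right_diff_distrib sum_subtractf)
  finally show ?case .
qed

text \<open>Minimum principle: where \<open>h\<close> is smallest and negative, the killed average
  is at least \<open>h\<close> itself, so the equation would give \<open>h \<ge> 1 + h\<close>.
  Nonnegativity, put back into the equation, gives the bound 1.\<close>

lemma hitting_system_ge_1:
  assumes deg: "\<And>j. j < n \<Longrightarrow> degree n E j > 0" and "k < n"
    and h: "\<And>j. j < n \<Longrightarrow> j \<noteq> k \<Longrightarrow> h j = 1 + killed n E k h j"
    and j: "j < n" "j \<noteq> k"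
  shows "h j \<ge> (1::real)"
proof -
  have nonneg: "h j \<ge> 0" if "j < n" "j \<noteq> k" for j
  proof (rule ccontr)
    assume neg: "\<not> h j \<ge> 0"
    let ?S = "{0..<n} - {k}"
    have ne: "finite (h ` ?S)" "h ` ?S \<noteq> {}" using that by auto
    obtain i where i: "i \<in> ?S" "Min (h ` ?S) = h i" using Min_in[OF ne] by (rule imageE) blast
    then have i: "i \<in> ?S" "\<And>l. l \<in> ?S \<Longrightarrow> h i \<le> h l" using Min_le[OF ne(1)] by (auto simp del: Min_le_iff)
    have hi: "h i < 0" using i(2)[of j] that neg by auto
    have "h i * killed n E k (\<lambda>_. 1) i = killed n E k (\<lambda>_. h i) i"
      using killed_cmult[of n E k "h i" "\<lambda>_. 1" i] by simp
    also have "\<dots> \<le> killed n E k h i" using i by (intro killed_mono) auto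
    also have "\<dots> = h i - 1" using h[of i] i by auto
    finally have "h i * (1 - trans n E i k) \<le> h i - 1"
      using killed_one[of n E i k] deg i assms(2) by auto
    moreover have "h i * trans n E i k \<le> 0"
      using hi trans_nonneg by (simp add: mult_nonpos_nonneg)
    ultimately show False by (simp add: algebra_simps)
  qed
  have "killed n E k (\<lambda>_. 0) j \<le> killed n E k h j" using nonneg by (intro killed_mono) auto
  then show ?thesis using h[OF j] by (simp add: killed_def)
qed

text \<open>A solution \<open>h\<close> of the one-step equations brings its own convergence
  estimate: \<open>killed\<close> turns \<open>h\<close> into \<open>h - 1\<close>, which is at most
  a fixed fraction of \<open>h\<close>, so the probability of not having met \<open>k\<close> decays
  geometrically.\<close>

lemma mfpt_eqI:
  assumes deg: "\<And>j. j < n \<Longrightarrow> degree n E j > 0" and k: "k < n"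
    and h: "\<And>j. j < n \<Longrightarrow> j \<noteq> k \<Longrightarrow> h j = 1 + killed n E k h j"
    and j: "j < n" "j \<noteq> k"
  shows "mfpt n E j k = h j"
proof -
  let ?S = "{0..<n} - {k}"
  \<comment> \<open>\<open>G t\<close> is the probability of avoiding \<open>k\<close> during the
    first \<open>t\<close> steps; \<open>R t\<close> is the remainder after unfolding the equation
    for \<open>h\<close> \<open>t\<close> times.\<close>
  define G where "G = (\<lambda>t. (killed n E k ^^ t) (\<lambda>_. 1))"
  define R where "R = (\<lambda>t. (killed n E k ^^ t) h)"
  have G_Suc: "G (Suc t) i = killed n E k (G t) i" for t i by (simp add: G_def)
  have R_Suc: "R (Suc t) i = killed n E k (R t) i" for t i by (simp add: R_def)
  have h1: "1 \<le> h i" if "i < n" "i \<noteq> k" for i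
    using hitting_system_ge_1[of n E k h i] deg k h that by blast
  define M where "M = Max (h ` ?S)"
  have hM: "h i \<le> M" if "i < n" "i \<noteq> k" for i
    unfolding M_def using that by (intro Max_ge) auto
  have M1: "1 \<le> M" using h1[OF j] hM[OF j] by linarith
  \<comment> \<open>Chosen so that \<open>h i - 1 \<le> q * h i\<close> says the same as
    \<open>h i \<le> M\<close>.\<close>
  define q where "q = 1 - 1 / M"
  have q: "0 \<le> q" "q < 1" using M1 by (auto simp: q_def field_simps)
  have R_le: "R t i \<le> q ^ t * h i" if "i < n" "i \<noteq> k" for t i
    using that
  proof (induction t arbitrary: i)
    case 0 then show ?case by (simp add: R_def)
  next
    case (Suc t)
    have "R (Suc t) i \<le> killed n E k (\<lambda>l. q ^ t * h l) i"
      unfolding R_Suc using Suc.IH by (intro killed_mono) auto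
    also have "\<dots> = q ^ t * (h i - 1)" using h[of i] Suc.prems by (simp add: killed_cmult)
    also have "\<dots> \<le> q ^ t * (q * h i)"
      using hM[OF Suc.prems] M1 q by (intro mult_left_mono) (auto simp: q_def field_simps)
    finally show ?case by (simp add: mult_ac)
  qed
  have G_le: "G t i \<le> R t i" if "i < n" "i \<noteq> k" for t i
    using that
  proof (induction t arbitrary: i)
    case 0 then show ?case using h1 by (simp add: R_def G_def)
  next
    case (Suc t)
    then show ?case unfolding R_Suc G_Suc by (intro killed_mono) auto
  qed
  have G_nonneg: "0 \<le> G t i" for t i unfolding G_def by (rule killed_power_nonneg) simp
  have h_split: "h i = (\<Sum>t<N. G t i) + R N i" if "i < n" "i \<noteq> k" for N i
    using that
  proof (induction N arbitrary: i)
    case 0 then show ?case by (simp add: R_def)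
  next
    case (Suc N)
    have "h i = 1 + killed n E k h i" using h Suc.prems by blast
    also have "killed n E k h i = killed n E k (\<lambda>l. (\<Sum>t<N. G t l) + R N l) i"
      unfolding killed_def using Suc.IH by (intro sum.cong refl arg_cong2[of _ _ _ _ "(*)"]) auto
    also have "\<dots> = (\<Sum>t<N. G (Suc t) i) + R (Suc N) i"
      unfolding G_Suc R_Suc killed_def
      by (simp add: distrib_left sum.distrib sum_distrib_left sum.swap[of _ "{..<N}"])
    finally show ?case unfolding sum.lessThan_Suc_shift by (simp add: G_def)
  qed
  \<comment> \<open>Summation by parts: the weights \<open>t + 1\<close> against differences of
    \<open>G\<close> leave the plain sum of \<open>G\<close> and one boundary term.\<close>
  have partial: "(\<Sum>t<N. real (t + 1) * first_passage n E t j k) = h j - R N j - real N * G N j" for N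
  proof -
    have "(\<Sum>t<N. real (t + 1) * first_passage n E t j k) =
        (\<Sum>t<N. real (t + 1) * (G t j - G (Suc t) j))"
      using first_passage_killed[of n E k j] deg k j by (simp add: G_def)
    also have "\<dots> = (\<Sum>t<N. G t j) - real N * G N j"
      by (induction N) (auto simp: algebra_simps)
    finally show ?thesis using h_split[OF j, of N] by simp
  qed
  have qlim: "(\<lambda>N. q ^ N * h j) \<longlonglongrightarrow> 0" "(\<lambda>N. real N * q ^ N * h j) \<longlonglongrightarrow> 0"
    using q powser_times_n_limit_0[of q]
    by (auto intro!: tendsto_mult_left_zero LIMSEQ_realpow_zero)
  have "0 \<le> R N j" for N using order_trans[OF G_nonneg G_le[OF j]] .
  then have R0: "(\<lambda>N. R N j) \<longlonglongrightarrow> 0"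
    by (intro real_tendsto_sandwich[OF _ _ tendsto_const qlim(1)]) (auto simp: R_le[OF j])
  have "G N j \<le> q ^ N * h j" for N using G_le[OF j, of N] R_le[OF j, of N] by linarith
  then have NG0: "(\<lambda>N. real N * G N j) \<longlonglongrightarrow> 0"
    by (intro real_tendsto_sandwich[OF _ _ tendsto_const qlim(2)])
      (auto simp: G_nonneg mult.assoc intro!: mult_left_mono always_eventually)
  have "(\<lambda>N. h j - R N j - real N * G N j) \<longlonglongrightarrow> h j - 0 - 0"
    by (intro tendsto_intros R0 NG0)
  then have "(\<lambda>t. real (t + 1) * first_passage n E t j k) sums h j"
    unfolding sums_def partial by simp
  then show ?thesis unfolding mfpt_def by (rule sums_unique[symmetric])
qed

text \<open>The condition on \<open>r\<close> is the Laplace equation of the effective resistance: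
  its right-hand side depends on \<open>k\<close> only through a point mass, so
  \<open>\<tau>\<close> cancels when two columns of \<open>r\<close> are subtracted. An explicit
  \<open>r\<close> can thus be certified by this equation.\<close>

lemma kemeny_resistance:
  assumes deg: "\<And>j. j < n \<Longrightarrow> degree n E j > 0" and "n > 0"
    and r0: "\<And>k. k < n \<Longrightarrow> r k k = 0"
    and lap_r: "\<And>j k. j < n \<Longrightarrow> k < n \<Longrightarrow>
      lap n E (\<lambda>i. r i k) j = \<tau> j - (if j = k then 2 else 0)"
  defines "d \<equiv> \<lambda>x. real (degree n E x)"
  shows "kemeny n E = (\<Sum>k<n. \<Sum>x<n. d k * d x * r k x) / (2 * (\<Sum>x<n. d x))"
proof -
  \<comment> \<open>Tetali's formula for the hitting time of \<open>k\<close> from \<open>j\<close>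
    in terms of resistances.\<close>
  define h where "h = (\<lambda>k j. (\<Sum>x<n. d x * (r j k + r k x - r j x)) / 2)"
  have lap_h: "lap n E (h k) j = d j" if "j < n" "k < n" "j \<noteq> k" for j k
  proof -
    have "lap n E (h k) j = (\<Sum>l<n. \<Sum>x<n. d x * (adj E j l * (r j k - r l k) - adj E j l * (r j x - r l x)) / 2)"
      unfolding lap_def h_def
      by (simp add: diff_divide_distrib[symmetric] sum_divide_distrib sum_subtractf[symmetric] sum_distrib_left algebra_simps)
    also have "\<dots> = (\<Sum>x<n. d x * (lap n E (\<lambda>i. r i k) j - lap n E (\<lambda>i. r i x) j) / 2)"
      unfolding lap_def
      by (subst sum.swap) (simp add: sum_subtractf sum_distrib_left sum_divide_distrib right_diff_distrib diff_divide_distrib)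
    also have "\<dots> = (\<Sum>x<n. if x = j then d x else 0)"
      using that by (intro sum.cong refl) (simp add: lap_r)
    finally show ?thesis using that by simp
  qed
  have hk: "h k k = 0" if "k < n" for k using that r0 by (simp add: h_def)
  have mfpt: "mfpt n E j k = h k j" if "j < n" "k < n" "j \<noteq> k" for j k
  proof (rule mfpt_eqI)
    fix j assume j: "j < n" "j \<noteq> k"
    have dj: "d j > 0" using deg[OF j(1)] by (simp add: d_def)
    have "killed n E k (h k) j = (\<Sum>l<n. adj E j l * h k l) / d j"
      unfolding killed_def trans_adj d_def
      using that(2) hk by (simp add: lessThan_atLeast0 sum.remove[of "{0..<n}" k] sum_divide_distrib)
    also have "(\<Sum>l<n. adj E j l * h k l) = d j * h k j - lap n E (h k) j"
      by (simp add: lap_def d_def degree_adj right_diff_distrib sum_subtractf sum_distrib_right)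
    finally show "h k j = 1 + killed n E k (h k) j"
      using lap_h[OF j(1) that(2) j(2)] dj by (simp add: diff_divide_distrib)
  qed (use that deg in auto)
  define s where "s = (\<Sum>x<n. d x)"
  have "kemeny n E = (\<Sum>k\<in>{0..<n} - {0}. h k 0 * (d k / s))"
    unfolding kemeny_def stat_dist_def s_def d_def using mfpt \<open>n > 0\<close> by (intro sum.cong refl) auto
  also have "\<dots> = (\<Sum>k<n. h k 0 * (d k / s))"
    using \<open>n > 0\<close> hk[of 0] by (simp add: lessThan_atLeast0 sum.remove[of "{0..<n}" 0])
  also have "\<dots> = (\<Sum>k<n. \<Sum>x<n. d k * d x * r 0 k + d k * d x * r k x - d k * d x * r 0 x) / (2 * s)"
  proof -
    have "h k 0 * (d k / s) = (d k * (\<Sum>x<n. d x * (r 0 k + r k x - r 0 x))) / (2 * s)" for k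
      by (simp add: h_def)
    moreover have "d k * (\<Sum>x<n. d x * (r 0 k + r k x - r 0 x)) =
        (\<Sum>x<n. d k * d x * r 0 k + d k * d x * r k x - d k * d x * r 0 x)" for k
      by (simp add: sum_distrib_left algebra_simps)
    ultimately show ?thesis by (simp only: sum_divide_distrib)
  qed
  \<comment> \<open>The terms with the starting vertex 0 cancel on swapping the summation variables,
    which is why the starting vertex does not matter.\<close>
  also have "(\<Sum>k<n. \<Sum>x<n. d k * d x * r 0 k + d k * d x * r k x - d k * d x * r 0 x) =
     (\<Sum>k<n. \<Sum>x<n. d k * d x * r k x)"
  proof -
    have "(\<Sum>k<n. \<Sum>x<n. d k * d x * r 0 k) = (\<Sum>k<n. \<Sum>x<n. d k * d x * r 0 x)"
      by (subst sum.swap) (simp add: mult.commute)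
    then show ?thesis by (simp add: sum.distrib sum_subtractf)
  qed
  finally show ?thesis by (simp add: s_def)
qed

section \<open>Distances in trees\<close>

definition gdist :: "(nat \<Rightarrow> nat \<Rightarrow> bool) \<Rightarrow> nat \<Rightarrow> nat \<Rightarrow> nat" where
  "gdist E x y = (LEAST k. (E ^^ k) x y)"

locale conn_graph =
  fixes n :: nat and E :: "nat \<Rightarrow> nat \<Rightarrow> bool"
  assumes simple: "simple_graph n E" and connected: "connected_graph n E"
begin

lemma E_less: "E x y \<Longrightarrow> x < n \<and> y < n"
  using simple by (auto simp: simple_graph_def)

lemma E_sym: "E x y \<Longrightarrow> E y x"
  using simple by (auto simp: simple_graph_def)

lemma E_irrefl: "\<not> E x x"
  using simple by (auto simp: simple_graph_def)

lemma gdist_walk: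
  assumes "x < n" "y < n"
  shows "(E ^^ gdist E x y) x y"
proof -
  have "E\<^sup>*\<^sup>* x y" using connected assms by (auto simp: connected_graph_def)
  then obtain k where "(E ^^ k) x y" by (auto simp: rtranclp_power)
  then show ?thesis unfolding gdist_def by (rule LeastI)
qed

lemma gdist_le: "(E ^^ k) x y \<Longrightarrow> gdist E x y \<le> k"
  unfolding gdist_def by (rule Least_le)

lemma gdist_self [simp]: "gdist E x x = 0"
  using gdist_le[of 0 x x] by simp

lemma gdist_eq_0: "x < n \<Longrightarrow> y < n \<Longrightarrow> gdist E x y = 0 \<longleftrightarrow> x = y"
  using gdist_walk[of x y] by auto

lemma walk_rev: "(E ^^ k) x y \<Longrightarrow> (E ^^ k) y x"
proof (induction k arbitrary: y)
  case (Suc k)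
  then obtain z where "(E ^^ k) x z" "E z y" by (auto elim: relpowp_Suc_E)
  then show ?case using relpowp_Suc_I2[of E y z k x] E_sym Suc.IH by blast
qed auto

lemma gdist_sym: "gdist E x y = gdist E y x"
  unfolding gdist_def using walk_rev by (intro arg_cong[of _ _ Least]) blast

lemma gdist_triangle:
  assumes "x < n" "y < n" "z < n"
  shows "gdist E x z \<le> gdist E x y + gdist E y z"
proof (rule gdist_le)
  show "(E ^^ (gdist E x y + gdist E y z)) x z"
    using gdist_walk assms by (auto simp: relpowp_add)
qed

lemma gdist_edge: "E x y \<Longrightarrow> gdist E x y = 1"
  using gdist_le[of 1 x y] gdist_eq_0[of x y] E_less[of x y] E_irrefl[of x]
  by (cases "gdist E x y") auto

lemma gdist_edge_le:
  assumes "E x y" "z < n"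
  shows "gdist E x z \<le> gdist E y z + 1"
  using gdist_triangle[of x y z] gdist_edge[OF assms(1)] E_less[OF assms(1)] assms(2) by auto

lemma closer_neighbour:
  assumes "x < n" "k < n" "x \<noteq> k"
  obtains y where "E x y" "y < n" "gdist E x k = Suc (gdist E y k)"
proof -
  obtain m where m: "gdist E x k = Suc m"
    using gdist_eq_0[of x k] assms by (cases "gdist E x k") auto
  then have "(E ^^ Suc m) x k" using gdist_walk[of x k] assms by simp
  then obtain y where y: "E x y" "(E ^^ m) y k" by (rule relpowp_Suc_E2)
  have "gdist E y k \<le> m" using gdist_le y(2) .
  moreover have "gdist E x k \<le> gdist E y k + 1" using gdist_edge_le y(1) assms(2) .
  ultimately show ?thesis using that[of y] y(1) E_less m by auto
qed

text \<open>A certificate for distances: by \<open>lip\<close> the value of \<open>\<phi>\<close>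
  drops by at most 1 per step, so no walk to \<open>k\<close> is shorter than
  \<open>\<phi> x\<close>; descending by \<open>dec\<close> produces a walk of that length.\<close>

lemma gdist_eqI:
  assumes "k < n" "\<phi> k = 0"
    and lip: "\<And>x y. E x y \<Longrightarrow> \<phi> x \<le> Suc (\<phi> y)"
    and dec: "\<And>x. x < n \<Longrightarrow> x \<noteq> k \<Longrightarrow> \<exists>y. E x y \<and> \<phi> x = Suc (\<phi> y)"
    and "x < n"
  shows "gdist E x k = \<phi> x"
proof (rule antisym)
  have "\<phi> x \<le> m + \<phi> y" if "(E ^^ m) x y" for m y
    using that
  proof (induction m arbitrary: y)
    case (Suc m)
    then obtain z where "(E ^^ m) x z" "E z y" by (auto elim: relpowp_Suc_E)
    then show ?case using Suc.IH[of z] lip[of z y] by simp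
  qed simp
  from this[OF gdist_walk[OF \<open>x < n\<close> \<open>k < n\<close>]] show "\<phi> x \<le> gdist E x k"
    using assms(2) by simp
  show "gdist E x k \<le> \<phi> x"
    using \<open>x < n\<close>
  proof (induction "\<phi> x" arbitrary: x rule: less_induct)
    case less
    show ?case
    proof (cases "x = k")
      case False
      then obtain y where y: "E x y" "\<phi> x = Suc (\<phi> y)" using dec less.prems by blast
      then have "gdist E y k \<le> \<phi> y" using less.hyps[of y] E_less by auto
      then show ?thesis using gdist_edge_le[OF y(1) assms(1)] y(2) by simp
    qed simp
  qed
qed

lemma degree_pos:
  assumes "n > 1" "x < n"
  shows "degree n E x > 0"
proof -
  obtain k where "k < n" "k \<noteq> x" using assms by (metis gr_implies_not_zero nat_neq_iff One_nat_def zero_less_one order_less_trans)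
  then obtain y where "E x y" "y < n" using closer_neighbour[of x k] assms by metis
  then have "y \<in> {j. j < n \<and> E x j}" by simp
  then show ?thesis unfolding degree_def by (subst card_gt_0_iff) auto
qed

end

section \<open>Parents, distances and Laplacians in a tree\<close>

locale tree_graph =
  fixes n :: nat and E :: "nat \<Rightarrow> nat \<Rightarrow> bool"
  assumes tree: "is_tree n E"

sublocale tree_graph \<subseteq> conn_graph n E
  using tree by unfold_locales (auto simp: is_tree_def)

context tree_graph
begin

text \<open>Rooting at \<open>k\<close>, the edges from each other vertex to its parent are \<open>n - 1\<close> distinct
  edges, hence all of them.\<close>

lemma parents_exist:
  assumes "k < n"
  obtains p where "\<And>x. x < n \<Longrightarrow> x \<noteq> k \<Longrightarrow> E x (p x) \<and> gdist E x k = Suc (gdist E (p x) k)"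
    and "\<And>x y. E x y \<Longrightarrow> (x \<noteq> k \<and> y = p x) \<or> (y \<noteq> k \<and> x = p y)"
proof -
  have "\<forall>x. \<exists>y. x < n \<longrightarrow> x \<noteq> k \<longrightarrow> E x y \<and> gdist E x k = Suc (gdist E y k)"
    using closer_neighbour[of _ k] assms by metis
  then obtain p where p: "\<And>x. x < n \<Longrightarrow> x \<noteq> k \<Longrightarrow> E x (p x) \<and> gdist E x k = Suc (gdist E (p x) k)"
    by metis
  define e where "e = (\<lambda>x. (min x (p x), max x (p x)))"
  define S where "S = {..<n} - {k}"
  let ?Es = "{(i, j). i < j \<and> j < n \<and> E i j}"
  have fin: "finite ?Es" by (rule finite_subset[of _ "{..<n} \<times> {..<n}"]) auto
  \<comment> \<open>Two vertices with the same parent edge would be each other's parent, hence each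
    farther from \<open>k\<close> than the other.\<close>
  have inj: "inj_on e S"
  proof (rule inj_onI)
    fix x y assume xy: "x \<in> S" "y \<in> S" "e x = e y"
    show "x = y"
    proof (rule ccontr)
      assume "x \<noteq> y"
      then have "x = p y" "y = p x" using xy(3) by (auto simp: e_def min_def max_def split: if_splits)
      then show False using p[of x] p[of y] xy(1,2) by (auto simp: S_def)
    qed
  qed
  have sub: "e ` S \<subseteq> ?Es"
  proof
    fix z assume "z \<in> e ` S"
    then obtain x where x: "x \<in> S" "z = e x" by blast
    then have "E x (p x)" using p by (auto simp: S_def)
    then show "z \<in> ?Es" using x E_sym E_less E_irrefl
      by (auto simp: e_def min_def max_def order.strict_iff_order)
  qed
  have "card (e ` S) = n - 1" using inj assms by (simp add: card_image S_def)
  moreover have "card ?Es = n - 1" using tree by (simp add: is_tree_def num_edges_def)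
  ultimately have all: "e ` S = ?Es" using card_subset_eq[OF fin sub] by simp
  have "(x \<noteq> k \<and> y = p x) \<or> (y \<noteq> k \<and> x = p y)" if "E x y" for x y
  proof -
    have "(min x y, max x y) \<in> ?Es"
      using that E_sym[OF that] E_less[OF that] E_irrefl[of x]
      by (auto simp: min_def max_def order.strict_iff_order)
    then obtain z where "z \<in> S" "e z = (min x y, max x y)" unfolding all[symmetric] by auto
    then show ?thesis by (auto simp: e_def S_def min_def max_def split: if_splits)
  qed
  with p show ?thesis using that by blast
qed

lemma edge_dist:
  assumes "E x y" "k < n"
  shows "gdist E x k = Suc (gdist E y k) \<or> gdist E y k = Suc (gdist E x k)"
proof -
  obtain p where p: "\<And>x. x < n \<Longrightarrow> x \<noteq> k \<Longrightarrow> E x (p x) \<and> gdist E x k = Suc (gdist E (p x) k)"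
    and all: "\<And>x y. E x y \<Longrightarrow> (x \<noteq> k \<and> y = p x) \<or> (y \<noteq> k \<and> x = p y)"
    using parents_exist[OF assms(2)] by blast
  show ?thesis using all[OF assms(1)] p E_less[OF assms(1)] by auto
qed

lemma closer_unique:
  assumes "E x y" "E x z" "k < n"
    and "gdist E x k = Suc (gdist E y k)" "gdist E x k = Suc (gdist E z k)"
  shows "y = z"
proof -
  obtain p where p: "\<And>x. x < n \<Longrightarrow> x \<noteq> k \<Longrightarrow> E x (p x) \<and> gdist E x k = Suc (gdist E (p x) k)"
    and all: "\<And>x y. E x y \<Longrightarrow> (x \<noteq> k \<and> y = p x) \<or> (y \<noteq> k \<and> x = p y)"
    using parents_exist[OF assms(3)] by blast
  have "y = p x" if "E x y" "gdist E x k = Suc (gdist E y k)" for y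
    using all[OF that(1)] p[of y] E_less[OF that(1)] that(2) by auto
  then show ?thesis using assms by blast
qed

text \<open>For \<open>j \<noteq> k\<close> one neighbour is nearer to \<open>k\<close> and all
  others are farther; for \<open>j = k\<close> all are farther. This is the equation required by
  \<open>kemeny_resistance\<close>: in a tree the resistance is the distance.\<close>

lemma lap_gdist:
  assumes "j < n" "k < n"
  shows "lap n E (\<lambda>x. real (gdist E x k)) j = 2 - real (degree n E j) - (if j = k then 2 else 0)"
proof (cases "j = k")
  case True
  have eq: "adj E j l * (real (gdist E j k) - real (gdist E l k)) = - adj E j l" for l
    using gdist_edge[of j l] gdist_sym[of j l] True by (auto simp: adj_def)
  show ?thesis unfolding lap_def eq using True by (simp add: degree_adj sum_negf)
next
  case False
  obtain y where y: "E j y" "y < n" "gdist E j k = Suc (gdist E y k)"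
    using closer_neighbour[of j k] assms False by blast
  have "adj E j l * (real (gdist E j k) - real (gdist E l k)) = (if l = y then 2 else 0) - adj E j l" for l
    using edge_dist[of j l k] closer_unique[of j l y k] y assms by (auto simp: adj_def)
  then show ?thesis using False y(2) by (simp add: lap_def degree_adj sum_subtractf)
qed

end

section \<open>Green's identity and degree-weighted sums of distances\<close>

lemma (in conn_graph) adj_sym: "adj E j l = adj E l j"
  using E_sym by (auto simp: adj_def)

text \<open>Averaging the sum with its copy in which the ends of each edge are exchanged gives the
  Dirichlet form, which is symmetric in \<open>f\<close> and \<open>g\<close>.\<close>

lemma (in conn_graph) lap_green:
  "(\<Sum>j<n. g j * lap n E f j) = (\<Sum>j<n. \<Sum>l<n. adj E j l * ((g j - g l) * (f j - f l))) / 2"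
proof -
  have a: "(\<Sum>j<n. g j * lap n E f j) = (\<Sum>j<n. \<Sum>l<n. adj E j l * (g j * (f j - f l)))"
    by (simp add: lap_def sum_distrib_left mult_ac)
  also have "\<dots> = (\<Sum>j<n. \<Sum>l<n. adj E l j * (g l * (f l - f j)))"
    by (rule sum.swap)
  finally have b: "(\<Sum>j<n. g j * lap n E f j) = (\<Sum>j<n. \<Sum>l<n. adj E j l * (g l * (f l - f j)))"
    by (simp add: adj_sym)
  have "2 * (\<Sum>j<n. g j * lap n E f j) =
      (\<Sum>j<n. \<Sum>l<n. adj E j l * (g j * (f j - f l)) + adj E j l * (g l * (f l - f j)))"
    using a b by (simp add: sum.distrib)
  then show ?thesis by (simp add: algebra_simps)
qed

lemma (in conn_graph) lap_selfadjoint: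
  "(\<Sum>j<n. g j * lap n E f j) = (\<Sum>j<n. f j * lap n E g j)"
  unfolding lap_green by (simp add: mult_ac)

lemma lap_const: "lap n E (\<lambda>_. a) j = 0"
  by (simp add: lap_def)

text \<open>A Leibniz rule. Its last sum, the local energy of \<open>f\<close>, does not involve
  \<open>a\<close>; with \<open>a = bs k\<close> it can therefore become part of the
  \<open>\<tau>\<close> of \<open>kemeny_resistance\<close>.\<close>

lemma lap_square: "lap n E (\<lambda>x. (f x - a)\<^sup>2) j =
    2 * (f j - a) * lap n E f j - (\<Sum>l<n. adj E j l * (f j - f l)\<^sup>2)"
  unfolding lap_def sum_distrib_left sum_subtractf[symmetric]
  by (intro sum.cong refl) (simp add: algebra_simps power2_eq_square)

context tree_graph
begin

abbreviation rho :: "nat \<Rightarrow> nat \<Rightarrow> real" where "rho x y \<equiv> real (gdist E x y)"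
abbreviation deg :: "nat \<Rightarrow> real" where "deg x \<equiv> real (degree n E x)"

lemma n_pos: "n > 0"
  using connected by (auto simp: connected_graph_def)

text \<open>The Laplacian of any function sums to zero; for a distance function this yields the
  degree sum.\<close>

lemma sum_degree: "(\<Sum>x<n. deg x) = 2 * (real n - 1)"
proof -
  have "(\<Sum>j<n. 1 * lap n E (\<lambda>x. rho x 0) j) = 0"
    by (subst lap_selfadjoint) (simp add: lap_const)
  moreover have "(\<Sum>j<n. 1 * lap n E (\<lambda>x. rho x 0) j) = (\<Sum>j<n. 2 - deg j - (if j = 0 then 2 else 0))"
    using n_pos by (intro sum.cong refl) (simp add: lap_gdist)
  ultimately show ?thesis using n_pos by (simp add: sum_subtractf)
qed

text \<open>Green's identity with both functions equal to the distance from \<open>y\<close>: it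
  changes by 1 along every edge, so the energy is the number of edges, \<open>n - 1\<close>.\<close>

lemma sum_degree_dist:
  assumes "y < n"
  shows "(\<Sum>x<n. deg x * rho x y) = 2 * (\<Sum>x<n. rho x y) - (real n - 1)"
proof -
  have unit: "adj E j l * ((rho j y - rho l y) * (rho j y - rho l y)) = adj E j l" for j l
    using edge_dist[of j l y] assms by (auto simp: adj_def)
  have "(\<Sum>x<n. rho x y * lap n E (\<lambda>x. rho x y) x) = real n - 1"
    unfolding lap_green unit by (simp add: degree_adj[symmetric] sum_degree)
  moreover have "(\<Sum>x<n. rho x y * lap n E (\<lambda>x. rho x y) x) = (\<Sum>x<n. 2 * rho x y - deg x * rho x y)"
    using assms by (intro sum.cong refl) (auto simp: lap_gdist algebra_simps)
  ultimately show ?thesis by (simp add: sum_subtractf sum_distrib_left[symmetric])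
qed

lemma kemeny_tree:
  assumes "n > 1"
  shows "kemeny n E = (\<Sum>x<n. \<Sum>y<n. rho x y) / (real n - 1) - (2 * real n - 1) / 2"
proof -
  define W where "W = (\<Sum>x<n. \<Sum>y<n. rho x y)"
  have "(\<Sum>k<n. \<Sum>x<n. deg k * deg x * rho k x) = (\<Sum>x<n. \<Sum>k<n. deg k * deg x * rho k x)"
    by (rule sum.swap)
  also have "\<dots> = (\<Sum>x<n. deg x * (\<Sum>k<n. deg k * rho k x))"
    by (simp add: sum_distrib_left mult_ac)
  also have "\<dots> = (\<Sum>x<n. deg x * (2 * (\<Sum>k<n. rho k x) - (real n - 1)))"
    by (simp add: sum_degree_dist)
  also have "\<dots> = 2 * (\<Sum>x<n. \<Sum>k<n. deg x * rho k x) - (real n - 1) * (\<Sum>x<n. deg x)"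
    by (simp add: sum_subtractf sum_distrib_left right_diff_distrib mult_ac)
  also have "(\<Sum>x<n. \<Sum>k<n. deg x * rho k x) = (\<Sum>k<n. \<Sum>x<n. deg x * rho x k)"
    by (subst sum.swap) (simp add: gdist_sym)
  also have "\<dots> = 2 * W - real n * (real n - 1)"
    by (simp add: sum_degree_dist sum_subtractf sum_distrib_left[symmetric] W_def)
      (subst sum.swap, simp)
  finally have Q: "(\<Sum>k<n. \<Sum>x<n. deg k * deg x * rho k x) =
      4 * W - 2 * (real n - 1) * (2 * real n - 1)"
    unfolding sum_degree by (simp add: algebra_simps)
  have "kemeny n E = (\<Sum>k<n. \<Sum>x<n. deg k * deg x * rho k x) / (2 * (\<Sum>x<n. deg x))"
    using degree_pos n_pos assms
    by (intro kemeny_resistance[where \<tau> = "\<lambda>j. 2 - deg j"]) (auto simp: lap_gdist)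
  then show ?thesis unfolding Q sum_degree W_def[symmetric] using assms by (simp add: field_simps)
qed

end

section \<open>Adding an edge to a tree\<close>

locale tree_chord = tree_graph +
  fixes u v :: nat
  assumes u: "u < n" and v: "v < n" and uv: "u \<noteq> v" and not_edge: "\<not> E u v"
begin

text \<open>The new edge closes a cycle of length \<open>D + 1\<close>.\<close>

definition D :: nat where "D = gdist E u v"

lemma D_ge_2: "2 \<le> D"
proof (rule ccontr)
  assume "\<not> 2 \<le> D"
  moreover have "D \<noteq> 0" using gdist_eq_0 u v uv by (simp add: D_def)
  ultimately have "gdist E u v = 1" by (simp add: D_def)
  then have "(E ^^ 1) u v" using gdist_walk[OF u v] by metis
  then show False using not_edge by (simp only: relpowp_1)
qed

lemma n_gt_1: "n > 1" using u v uv by linarith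

text \<open>Induction on the distance to \<open>v\<close>: the neighbour \<open>a\<close> of
  \<open>x\<close> towards \<open>v\<close> already has an attachment vertex \<open>w i\<close>. If
  \<open>x\<close> is farther from \<open>u\<close> than \<open>a\<close>, it is attached at the
  same \<open>w i\<close>; otherwise \<open>x\<close> turns out to be the path vertex after
  \<open>a\<close>.\<close>

lemma spine_projection:
  obtains w where
    "\<And>i. i \<le> D \<Longrightarrow> w i < n \<and> gdist E (w i) v = i \<and> gdist E (w i) u = D - i"
    and "\<And>i j. i \<le> j \<Longrightarrow> j \<le> D \<Longrightarrow> gdist E (w i) (w j) \<le> j - i"
    and "\<And>x. x < n \<Longrightarrow> \<exists>i\<le>D. gdist E x v = gdist E x (w i) + i \<and>
      gdist E x u = gdist E x (w i) + (D - i)"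
proof -
  have "(E ^^ D) v u" using walk_rev[OF gdist_walk[OF u v]] by (simp add: D_def)
  then obtain w where w: "w 0 = v" "w D = u" "\<And>i. i < D \<Longrightarrow> E (w i) (w (Suc i))"
    by (auto simp: relpowp_fun_conv)
  have wn: "w i < n" if "i \<le> D" for i
    using that w(1,2) w(3)[of i] v u E_less[of "w i" "w (Suc i)"] by (cases "i = D") auto
  have wd: "gdist E (w i) (w j) \<le> j - i" if "i \<le> j" "j \<le> D" for i j
    using that
  proof (induction j)
    case (Suc j)
    show ?case
    proof (cases "i = Suc j")
      case False
      then have "gdist E (w i) (w (Suc j)) \<le> gdist E (w i) (w j) + gdist E (w j) (w (Suc j))"
        using wn Suc.prems by (intro gdist_triangle) auto
      then show ?thesis using Suc False gdist_edge[OF w(3)[of j]] by simp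
    qed simp
  qed simp
  have wv: "gdist E (w i) v = i" and wu: "gdist E (w i) u = D - i" if "i \<le> D" for i
  proof -
    have "gdist E (w i) v \<le> i" "gdist E (w i) u \<le> D - i"
      using wd[of 0 i] wd[of i D] that w(1,2) gdist_sym[of v] by auto
    moreover have "D \<le> gdist E (w i) u + gdist E (w i) v"
      using gdist_triangle[OF u wn[OF that] v] by (simp add: D_def gdist_sym[of u])
    ultimately show "gdist E (w i) v = i" "gdist E (w i) u = D - i" using that by linarith+
  qed
  have proj: "\<exists>i\<le>D. gdist E x v = gdist E x (w i) + i \<and> gdist E x u = gdist E x (w i) + (D - i)"
    if "x < n" for x
    using that
  proof (induction "gdist E x v" arbitrary: x rule: less_induct)
    case less
    show ?case
    proof (cases "x = v")
      case True
      then show ?thesis using w(1) by (auto intro!: exI[of _ 0] simp: D_def gdist_sym)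
    next
      case False
      obtain a where a: "E x a" "a < n" "gdist E x v = Suc (gdist E a v)"
        using closer_neighbour[of x v] less.prems v False by blast
      obtain i where i: "i \<le> D" "gdist E a v = gdist E a (w i) + i"
          "gdist E a u = gdist E a (w i) + (D - i)"
        using less.hyps[of a] a by auto
      have ax: "E a x" using a(1) E_sym by blast
      from edge_dist[OF a(1) u] show ?thesis
      proof
        assume far: "gdist E x u = Suc (gdist E a u)"
        have "gdist E x (w i) = Suc (gdist E a (w i))"
        proof (rule antisym)
          show "gdist E x (w i) \<le> Suc (gdist E a (w i))"
            using gdist_edge_le[OF a(1) wn[OF i(1)]] by simp
          show "Suc (gdist E a (w i)) \<le> gdist E x (w i)"
            using gdist_triangle[OF less.prems wn[OF i(1)] v] wv[OF i(1)] a(3) i(2) by simp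
        qed
        then show ?thesis using i a(3) far by auto
      next
        assume near: "gdist E a u = Suc (gdist E x u)"
        show ?thesis
        proof (cases "a = w i")
          case True
          have "i \<noteq> D" using near i(3) True w(2) by auto
          then have iD: "i < D" using i(1) by simp
          have "x = w (Suc i)"
            using closer_unique[OF ax _ u near, of "w (Suc i)"] w(3)[OF iD] True wu[of i] wu[of "Suc i"] iD
            by auto
          then show ?thesis using wv[of "Suc i"] wu[of "Suc i"] iD by (auto intro!: exI[of _ "Suc i"])
        next
          \<comment> \<open>For \<open>a\<close> off the path, the step from \<open>a\<close>
            towards \<open>w i\<close> is the step towards \<open>u\<close>, hence leads to
            \<open>x\<close>; but it also approaches \<open>v\<close>, while \<open>x\<close> is
            farther from \<open>v\<close> than \<open>a\<close>.\<close>
          case False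
          obtain z where z: "E a z" "z < n" "gdist E a (w i) = Suc (gdist E z (w i))"
            using closer_neighbour[OF a(2) wn[OF i(1)] False] by blast
          have "gdist E z u \<le> gdist E z (w i) + (D - i)"
            using gdist_triangle[OF z(2) wn[OF i(1)] u] wu[OF i(1)] by simp
          then have "gdist E a u = Suc (gdist E z u)"
            using gdist_edge_le[OF z(1) u] z(3) i(3) by simp
          then have "x = z" using closer_unique[OF ax z(1) u near] by simp
          moreover have "gdist E z v \<le> gdist E z (w i) + i"
            using gdist_triangle[OF z(2) wn[OF i(1)] v] wv[OF i(1)] by simp
          ultimately show ?thesis using a(3) i(2) z(3) by simp
        qed
      qed
    qed
  qed
  show ?thesis using that[of w] wn wv wu wd proj by blast
qed

text \<open>\<open>base x\<close> is the position on the path from \<open>v\<close> to \<open>u\<close> of the vertex nearest to \<open>x\<close>,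
  and \<open>ht x\<close> is the distance of \<open>x\<close> from that path.\<close>

definition base :: "nat \<Rightarrow> nat" where "base x = (gdist E x v + D - gdist E x u) div 2"
definition ht :: "nat \<Rightarrow> nat" where "ht x = gdist E x v - base x"

lemma base_eqI:
  assumes "gdist E x v = h + i" "gdist E x u = h + (D - i)" "i \<le> D"
  shows "base x = i" "ht x = h"
proof -
  have "gdist E x v + D - gdist E x u = 2 * i" using assms by simp
  then show "base x = i" by (simp add: base_def)
  then show "ht x = h" using assms by (simp add: ht_def)
qed

lemma dist_ends:
  assumes "x < n"
  shows "gdist E x v = ht x + base x" "gdist E x u = ht x + (D - base x)" "base x \<le> D"
proof -
  obtain h i where "gdist E x v = h + i" "gdist E x u = h + (D - i)" "i \<le> D"
    using spine_projection assms by metis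
  then show "gdist E x v = ht x + base x" "gdist E x u = ht x + (D - base x)" "base x \<le> D"
    using base_eqI[of x h i] by auto
qed

lemma rho_ends:
  assumes "x < n"
  shows "rho x v = real (ht x) + real (base x)" "rho x u = real (ht x) + real D - real (base x)"
  using dist_ends[OF assms] by simp_all

lemma base_ends [simp]: "base u = D" "ht u = 0" "base v = 0" "ht v = 0"
  using base_eqI[of u 0 D] base_eqI[of v 0 0] by (auto simp: D_def gdist_sym)

lemma dist_le:
  assumes "x < n" "y < n"
  shows "rho x y \<le> real (ht x) + real (ht y) + \<bar>real (base x) - real (base y)\<bar>"
proof -
  obtain w where w: "\<And>i. i \<le> D \<Longrightarrow> w i < n"
    and wd: "\<And>i j. i \<le> j \<Longrightarrow> j \<le> D \<Longrightarrow> gdist E (w i) (w j) \<le> j - i"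
    and proj: "\<And>x. x < n \<Longrightarrow> \<exists>i\<le>D. gdist E x v = gdist E x (w i) + i \<and>
      gdist E x u = gdist E x (w i) + (D - i)"
    using spine_projection by metis
  have wx: "gdist E x (w (base x)) = ht x" if "x < n" for x
    using proj[OF that] base_eqI[of x] by metis
  have "rho x y \<le> rho x (w (base x)) + rho (w (base x)) (w (base y)) + rho (w (base y)) y"
    using gdist_triangle[of x "w (base x)" y] gdist_triangle[of "w (base x)" "w (base y)" y]
      w dist_ends(3) assms by fastforce
  moreover have "rho (w (base x)) (w (base y)) \<le> \<bar>real (base x) - real (base y)\<bar>"
    using wd[of "base x" "base y"] wd[of "base y" "base x"] gdist_sym[of "w (base x)" "w (base y)"]
      dist_ends(3) assms by (cases "base x \<le> base y") fastforce+
  ultimately show ?thesis using wx assms gdist_sym[of "w (base y)" y] by simp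
qed

lemma base_surj:
  assumes "i \<le> D"
  shows "\<exists>x<n. base x = i"
proof -
  obtain w where "\<And>i. i \<le> D \<Longrightarrow> w i < n \<and> gdist E (w i) v = i \<and> gdist E (w i) u = D - i"
    using spine_projection by metis
  then have "w i < n" "base (w i) = i" using base_eqI[of "w i" 0 i] assms by auto
  then show ?thesis by blast
qed

text \<open>The neighbour in the direction of the attachment vertex is nearer to both
  \<open>u\<close> and \<open>v\<close>. Nearer neighbours being unique, all others are farther from
  both ends, so the two distances always change together.\<close>

lemma edge_off_path:
  assumes "E x y" "ht x > 0"
  shows "base y = base x" "ht x = Suc (ht y) \<or> ht y = Suc (ht x)"
proof -
  have xn: "x < n" and yn: "y < n" using E_less assms(1) by auto
  obtain w where wi: "\<And>i. i \<le> D \<Longrightarrow> w i < n \<and> gdist E (w i) v = i \<and> gdist E (w i) u = D - i"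
    and proj: "\<And>x. x < n \<Longrightarrow> \<exists>i\<le>D. gdist E x v = gdist E x (w i) + i \<and>
      gdist E x u = gdist E x (w i) + (D - i)"
    using spine_projection by metis
  obtain i where i: "i \<le> D" "gdist E x v = gdist E x (w i) + i"
      "gdist E x u = gdist E x (w i) + (D - i)" using proj[OF xn] by blast
  have w: "w i < n" using wi i(1) by blast
  have h: "gdist E x (w i) = ht x" "base x = i" using base_eqI i by auto
  then obtain z where z: "E x z" "z < n" "gdist E x (w i) = Suc (gdist E z (w i))"
    using closer_neighbour[OF xn w] assms(2) gdist_self by (metis less_numeral_extra(3))
  have zv: "gdist E z v \<le> gdist E z (w i) + i" and zu: "gdist E z u \<le> gdist E z (w i) + (D - i)"
    using gdist_triangle[OF z(2) w v] gdist_triangle[OF z(2) w u] wi[OF i(1)] by auto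
  then have zc: "gdist E x v = Suc (gdist E z v)" "gdist E x u = Suc (gdist E z u)"
    using gdist_edge_le[OF z(1) v] gdist_edge_le[OF z(1) u] i z(3) by auto
  have "(gdist E x v = Suc (gdist E y v) \<and> gdist E x u = Suc (gdist E y u)) \<or>
        (gdist E y v = Suc (gdist E x v) \<and> gdist E y u = Suc (gdist E x u))"
    using edge_dist[OF assms(1) u] edge_dist[OF assms(1) v] zc
      closer_unique[OF assms(1) z(1) v] closer_unique[OF assms(1) z(1) u] by metis
  then show "base y = base x" "ht x = Suc (ht y) \<or> ht y = Suc (ht x)"
    using dist_ends[OF xn] dist_ends[OF yn] by auto
qed

text \<open>When no height exceeds 1, all neighbours of a vertex off the path have height 0 and are
  nearer to \<open>v\<close>, so there is only one: the vertex is a leaf.\<close>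

lemma pendant_neighbour:
  assumes ht1: "\<forall>x<n. ht x \<le> 1" and x: "x < n" "ht x = 1"
  obtains a where "a < n" "ht a = 0" "base a = base x"
    and "\<And>y. y < n \<Longrightarrow> y \<noteq> x \<Longrightarrow> gdist E x y = Suc (gdist E a y)"
proof -
  have "x \<noteq> v" using x by auto
  then obtain a where a: "E x a" "a < n" using closer_neighbour[OF x(1) v] by blast
  have nb: "base z = base x \<and> ht z = 0" if "E x z" for z
    using edge_off_path[OF that] ht1 x E_less[OF that] by auto
  have step: "gdist E x y = Suc (gdist E a y)" if y: "y < n" "y \<noteq> x" for y
  proof -
    obtain z where z: "E x z" "z < n" "gdist E x y = Suc (gdist E z y)"
      using closer_neighbour[of x y] x y by metis
    have "gdist E x v = Suc (gdist E z v)" if "E x z" for z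
      using nb[OF that] dist_ends(1)[of z] dist_ends(1)[OF x(1)] x(2) E_less[OF that] by simp
    then have "z = a" using closer_unique[OF z(1) a(1) v] a z by blast
    then show ?thesis using z by simp
  qed
  show ?thesis using nb[OF a(1)] by (intro that[of a] step a(2)) auto
qed

text \<open>On the path the triangle inequality through \<open>v\<close> makes
  \<open>dist_le\<close> sharp, and a leaf lies exactly one step beyond its only neighbour. For
  \<open>x = y\<close> off the path the right-hand side would be \<open>2 * ht x\<close>.\<close>

lemma dist_eq:
  assumes ht1: "\<forall>x<n. ht x \<le> 1" and "x < n" "y < n" "x \<noteq> y"
  shows "rho x y = real (ht x) + real (ht y) + \<bar>real (base x) - real (base y)\<bar>"
proof -
  have path: "rho x y = \<bar>real (base x) - real (base y)\<bar>"
    if "x < n" "y < n" "ht x = 0" "ht y = 0" for x y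
    using dist_le[OF that(1,2)] that gdist_triangle[of x y v] gdist_triangle[of y x v] v
      gdist_sym[of x y] dist_ends(1)[OF that(1)] dist_ends(1)[OF that(2)] by auto
  have half: "rho x y = real (ht x) + \<bar>real (base x) - real (base y)\<bar>"
    if xy: "x < n" "y < n" "ht y = 0" "x \<noteq> y" for x y
  proof (cases "ht x = 0")
    case True then show ?thesis using path xy by simp
  next
    case False
    then have h: "ht x = 1" using ht1 xy(1) by fastforce
    then obtain a where "a < n" "ht a = 0" "base a = base x" "gdist E x y = Suc (gdist E a y)"
      using pendant_neighbour[OF ht1 xy(1) h] xy by metis
    then show ?thesis using path[of a y] xy h by simp
  qed
  show ?thesis
  proof (cases "ht y = 0")
    case True then show ?thesis using half assms by simp
  next
    case False
    then have h: "ht y = 1" using ht1 assms(3) by fastforce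
    then obtain a where a: "a < n" "ht a = 0" "base a = base y" "gdist E y x = Suc (gdist E a x)"
      using pendant_neighbour[OF ht1 assms(3) h] assms by metis
    show ?thesis
    proof (cases "a = x")
      case True then show ?thesis using a h gdist_sym[of x y] by simp
    next
      case False
      then show ?thesis using half[of x a] a assms h gdist_sym[of x y] gdist_sym[of x a] by simp
    qed
  qed
qed

end

section \<open>Laplacians and resistances after adding the edge\<close>

context tree_chord
begin

abbreviation G :: "nat \<Rightarrow> nat \<Rightarrow> bool" where "G \<equiv> add_edge E u v"
abbreviation degG :: "nat \<Rightarrow> real" where "degG x \<equiv> real (degree n G x)"
abbreviation bs :: "nat \<Rightarrow> real" where "bs x \<equiv> real (base x)"

lemma adj_chord: "adj G j l = adj E j l + of_bool (j = u \<and> l = v) + of_bool (j = v \<and> l = u)"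
  using uv not_edge E_sym by (auto simp: adj_def add_edge_def)

lemma sum_adj_chord:
  "(\<Sum>l<n. adj G j l * g l) = (\<Sum>l<n. adj E j l * g l) +
    (if j = u then g v else 0) + (if j = v then g u else 0)"
proof -
  have "(\<Sum>l<n. adj G j l * g l) = (\<Sum>l<n. adj E j l * g l +
      (if l = v then (if j = u then g l else 0) else 0) + (if l = u then (if j = v then g l else 0) else 0))"
    by (intro sum.cong refl) (auto simp: adj_chord algebra_simps)
  then show ?thesis using u v by (simp add: sum.distrib)
qed

lemma degree_chord: "degG x = deg x + (if x = u then 1 else 0) + (if x = v then 1 else 0)"
  using sum_adj_chord[of x "\<lambda>_. 1"] by (simp add: degree_adj)

lemma lap_chord: "lap n G f j = lap n E f j + (if j = u then f u - f v else 0) + (if j = v then f v - f u else 0)"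
  unfolding lap_def by (subst sum_adj_chord) auto

text \<open>\<open>bs\<close> is, up to a constant, half the difference of the distances to
  \<open>v\<close> and \<open>u\<close>: the potential of a unit current from \<open>u\<close> to
  \<open>v\<close> in the tree.\<close>

lemma lap_base:
  assumes "j < n"
  shows "lap n E bs j = (if j = u then 1 else 0) - (if j = v then 1 else 0)"
proof -
  have b: "bs x = (rho x v - rho x u + real D) / 2" if "x < n" for x
    using rho_ends[OF that] by simp
  have "lap n E bs j = (\<Sum>l<n. (adj E j l * (rho j v - rho l v) - adj E j l * (rho j u - rho l u)) / 2)"
    unfolding lap_def by (intro sum.cong refl) (simp add: b assms right_diff_distrib diff_divide_distrib add_divide_distrib)
  also have "\<dots> = (lap n E (\<lambda>x. rho x v) j - lap n E (\<lambda>x. rho x u) j) / 2"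
    by (simp add: lap_def sum_subtractf sum_divide_distrib[symmetric])
  finally show ?thesis using assms u v uv by (auto simp: lap_gdist)
qed

text \<open>The height is, up to a constant, half the sum of the two distances; the point masses at
  \<open>u\<close> and \<open>v\<close> turn the tree degree into the degree in
  \<open>G\<close>.\<close>

lemma lap_ht:
  assumes "j < n"
  shows "lap n E (\<lambda>x. real (ht x)) j = 2 - degG j"
proof -
  have b: "real (ht x) = (rho x v + rho x u - real D) / 2" if "x < n" for x
    using rho_ends[OF that] by simp
  have "lap n E (\<lambda>x. real (ht x)) j = (\<Sum>l<n. (adj E j l * (rho j v - rho l v) + adj E j l * (rho j u - rho l u)) / 2)"
    unfolding lap_def by (intro sum.cong refl) (simp add: b assms right_diff_distrib distrib_left diff_divide_distrib add_divide_distrib)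
  also have "\<dots> = (lap n E (\<lambda>x. rho x v) j + lap n E (\<lambda>x. rho x u) j) / 2"
    by (simp add: lap_def sum.distrib sum_divide_distrib[symmetric])
  finally show ?thesis using assms u v uv by (auto simp: lap_gdist degree_chord)
qed

text \<open>Heights vanish on the path, and \<open>base\<close> is constant along edges at vertices
  off it, so \<open>ht x\<close> times the Laplacian of \<open>\<phi> (base x)\<close> is zero
  everywhere. Self-adjointness moves the Laplacian to \<open>ht\<close>, where it is
  \<open>2 - degG\<close>.\<close>

lemma sum_degree_base: "(\<Sum>x<n. degG x * \<phi> (base x)) = 2 * (\<Sum>x<n. \<phi> (base x))"
proof -
  have "real (ht x) * lap n E (\<lambda>x. \<phi> (base x)) x = 0" for x
  proof (cases "ht x = 0")
    case False
    then have "adj E x l * (\<phi> (base x) - \<phi> (base l)) = 0" for l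
      using edge_off_path[of x l] by (auto simp: adj_def)
    then show ?thesis unfolding lap_def by (simp only: sum.neutral_const)
  qed simp
  then have "0 = (\<Sum>x<n. real (ht x) * lap n E (\<lambda>x. \<phi> (base x)) x)"
    by (simp only: sum.neutral_const)
  also have "\<dots> = (\<Sum>x<n. \<phi> (base x) * lap n E (\<lambda>x. real (ht x)) x)"
    by (rule lap_selfadjoint)
  also have "\<dots> = (\<Sum>x<n. 2 * \<phi> (base x) - degG x * \<phi> (base x))"
    by (intro sum.cong refl) (simp add: lap_ht algebra_simps)
  finally show ?thesis by (simp add: sum_subtractf sum_distrib_left)
qed

lemma sum_degreeG: "(\<Sum>x<n. degG x) = 2 * real n"
  using sum_degree_base[of "\<lambda>_. 1"] by simp

text \<open>The effective resistance: the two arcs of the new cycle of length \<open>D + 1\<close> act in parallel.\<close>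

definition res :: "nat \<Rightarrow> nat \<Rightarrow> real" where
  "res x y = rho x y - (bs x - bs y)\<^sup>2 / (real D + 1)"

text \<open>Everything depending on \<open>k\<close> must cancel except the point mass. The squared
  term leaves a dependence on \<open>bs k\<close> only at the two ends of the path, where the
  current through the new edge compensates it; the rest serves as \<open>\<tau>\<close>.\<close>

lemma lap_res:
  assumes "j < n" "k < n"
  shows "lap n G (\<lambda>x. res x k) j =
    2 - deg j + (\<Sum>l<n. adj E j l * (bs j - bs l)\<^sup>2) / (real D + 1)
      + (if j = u \<or> j = v then 1 / (real D + 1) - 1 else 0) - (if j = k then 2 else 0)"
proof -
  define c where "c = real D + 1"
  have c: "c > 0" "real D = c - 1" by (auto simp: c_def)
  define \<Gamma> where "\<Gamma> = (\<Sum>l<n. adj E j l * (bs j - bs l)\<^sup>2)"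
  have "lap n E (\<lambda>x. res x k) j = lap n E (\<lambda>x. rho x k) j - lap n E (\<lambda>x. (bs x - bs k)\<^sup>2) j / c"
    unfolding lap_def res_def c_def
    by (simp add: sum_divide_distrib sum_subtractf[symmetric] right_diff_distrib diff_divide_distrib algebra_simps)
  also have "\<dots> = 2 - deg j - (if j = k then 2 else 0) -
      (2 * (bs j - bs k) * ((if j = u then 1 else 0) - (if j = v then 1 else 0)) - \<Gamma>) / c"
    using assms by (simp add: lap_gdist lap_square lap_base \<Gamma>_def)
  finally have T: "lap n E (\<lambda>x. res x k) j = 2 - deg j - (if j = k then 2 else 0) -
      (2 * (bs j - bs k) * ((if j = u then 1 else 0) - (if j = v then 1 else 0)) - \<Gamma>) / c" .
  have "rho u k = real (ht k) + real D - bs k" "rho v k = real (ht k) + bs k"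
    using rho_ends[OF assms(2)] gdist_sym[of u k] gdist_sym[of v k] by auto
  then have chord: "res u k - res v k = c - 1 - 2 * bs k - ((c - 1 - bs k)\<^sup>2 - (bs k)\<^sup>2) / c"
    by (simp add: res_def c diff_divide_distrib)
  have *: "- (2 * (c - 1 - bs k) - \<Gamma>) / c + (res u k - res v k) = \<Gamma> / c + 1 / c - 1"
    "- (2 * bs k - \<Gamma>) / c - (res u k - res v k) = \<Gamma> / c + 1 / c - 1"
    unfolding chord using c(1) by (simp_all add: field_simps power2_eq_square)
  show ?thesis
    unfolding lap_chord T c_def[symmetric] \<Gamma>_def[symmetric]
    using * uv by (cases "j = u"; cases "j = v") (simp_all add: c diff_divide_distrib add_divide_distrib)
qed

lemma degreeG_pos: "x < n \<Longrightarrow> degree n G x > 0"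
  using degree_chord[of x] degree_pos[OF n_gt_1, of x] by (simp split: if_splits)

lemma kemeny_chord: "kemeny n G = (\<Sum>x<n. \<Sum>y<n. degG x * degG y * res x y) / (4 * real n)"
proof -
  have "kemeny n G = (\<Sum>k<n. \<Sum>x<n. degG k * degG x * res k x) / (2 * (\<Sum>x<n. degG x))"
    by (rule kemeny_resistance[OF degreeG_pos n_pos _ lap_res]) (simp_all add: res_def)
  then show ?thesis by (simp add: sum_degreeG)
qed

section \<open>Reduction to sums without degree weights\<close>

definition S1 :: real where "S1 = (\<Sum>x<n. \<Sum>y<n. \<bar>bs x - bs y\<bar>)"
definition S2 :: real where "S2 = (\<Sum>x<n. \<Sum>y<n. (bs x - bs y)\<^sup>2)"
definition H :: real where "H = (\<Sum>x<n. real (ht x))"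
text \<open>Twice the Wiener index of the tree, as the pairs are ordered.\<close>

definition W :: real where "W = (\<Sum>x<n. \<Sum>y<n. rho x y)"

lemma sum_degreeG_base_sq: "(\<Sum>x<n. \<Sum>y<n. degG x * degG y * (bs x - bs y)\<^sup>2) = 4 * S2"
proof -
  have "(\<Sum>x<n. \<Sum>y<n. degG x * degG y * (bs x - bs y)\<^sup>2) =
      (\<Sum>x<n. degG x * (\<Sum>y<n. degG y * (real (base x) - real (base y))\<^sup>2))"
    by (simp add: sum_distrib_left mult_ac)
  also have "\<dots> = (\<Sum>x<n. degG x * (2 * (\<Sum>y<n. (real (base x) - real (base y))\<^sup>2)))"
    by (subst sum_degree_base) (rule refl)
  also have "\<dots> = 2 * (\<Sum>x<n. 2 * (\<Sum>y<n. (real (base x) - real (base y))\<^sup>2))"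
    by (rule sum_degree_base[of "\<lambda>b. 2 * (\<Sum>y<n. (real b - real (base y))\<^sup>2)"])
  finally show ?thesis by (simp add: S2_def sum_distrib_left[symmetric])
qed

lemma sum_degG:
  "(\<Sum>x<n. degG x * f x) = (\<Sum>x<n. deg x * f x) + f u + f v"
proof -
  have "(\<Sum>x<n. degG x * f x) = (\<Sum>x<n. deg x * f x + (if x = u then f x else 0) + (if x = v then f x else 0))"
    by (intro sum.cong refl) (simp add: degree_chord algebra_simps)
  then show ?thesis using u v by (simp add: sum.distrib)
qed

lemma sum_degreeG_dist:
  assumes "y < n"
  shows "(\<Sum>x<n. degG x * rho x y) = 2 * (\<Sum>x<n. rho x y) - (real n - 1) + 2 * real (ht y) + real D"
  using sum_degree_dist[OF assms] rho_ends[OF assms] gdist_sym[of u y] gdist_sym[of v y]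
  by (simp add: sum_degG)

lemma dist_sum_ends: "(\<Sum>x<n. rho x u) + (\<Sum>x<n. rho x v) = real n * real D + 2 * H"
proof -
  have "(\<Sum>x<n. rho x u) + (\<Sum>x<n. rho x v) = (\<Sum>x<n. real D + 2 * real (ht x))"
    unfolding sum.distrib[symmetric] by (intro sum.cong refl) (simp add: rho_ends)
  then show ?thesis by (simp add: sum.distrib H_def sum_distrib_left)
qed

lemma sum_degreeG_ht: "(\<Sum>x<n. degG x * real (ht x)) = 2 * H + real D - (real n - 1)"
proof -
  have "(\<Sum>x<n. deg x * real (ht x)) = (\<Sum>x<n. (deg x * rho x u + deg x * rho x v - deg x * real D) / 2)"
    by (intro sum.cong refl) (simp add: rho_ends algebra_simps)
  also have "\<dots> = ((\<Sum>x<n. deg x * rho x u) + (\<Sum>x<n. deg x * rho x v) - (\<Sum>x<n. deg x) * real D) / 2"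
    by (simp add: sum_divide_distrib[symmetric] sum.distrib sum_subtractf sum_distrib_right)
  also have "\<dots> = 2 * H + real D - (real n - 1)"
    using dist_sum_ends u v by (simp add: sum_degree_dist sum_degree field_simps)
  finally show ?thesis by (simp add: sum_degG)
qed

text \<open>The weights are removed one variable at a time; the extra degrees at \<open>u\<close>
  and \<open>v\<close> each time add \<open>rho u y + rho v y = 2 * ht y + D\<close>.\<close>

lemma sum_degreeG_dist_degreeG:
  "(\<Sum>x<n. \<Sum>y<n. degG x * degG y * rho x y) =
    4 * W + 8 * H + 4 * real n * (real D - real n + 1) + 2 * real D - 2 * (real n - 1)"
proof -
  have "(\<Sum>x<n. \<Sum>y<n. degG x * degG y * rho x y) = (\<Sum>y<n. degG y * (\<Sum>x<n. degG x * rho x y))"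
    by (subst sum.swap) (simp add: sum_distrib_left mult_ac)
  also have "\<dots> = (\<Sum>y<n. 2 * (\<Sum>x<n. degG y * rho x y) + degG y * (real D - (real n - 1)) + 2 * (degG y * real (ht y)))"
  proof (rule sum.cong[OF refl])
    fix y assume "y \<in> {..<n}"
    then have "degG y * (\<Sum>x<n. degG x * rho x y) =
        degG y * (2 * (\<Sum>x<n. rho x y) - (real n - 1) + 2 * real (ht y) + real D)"
      by (simp add: sum_degreeG_dist)
    then show "degG y * (\<Sum>x<n. degG x * rho x y) =
        2 * (\<Sum>x<n. degG y * rho x y) + degG y * (real D - (real n - 1)) + 2 * (degG y * real (ht y))"
      unfolding sum_distrib_left[symmetric] by (simp add: algebra_simps)
  qed
  also have "\<dots> = 2 * (\<Sum>y<n. \<Sum>x<n. degG y * rho x y) + (\<Sum>y<n. degG y) * (real D - (real n - 1)) + 2 * (\<Sum>y<n. degG y * real (ht y))"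
    by (simp add: sum.distrib sum_distrib_left sum_distrib_right)
  also have "(\<Sum>y<n. \<Sum>x<n. degG y * rho x y) = (\<Sum>x<n. \<Sum>y<n. degG y * rho y x)"
    by (subst sum.swap) (simp add: gdist_sym)
  also have "\<dots> = (\<Sum>x<n. 2 * (\<Sum>y<n. rho y x) + 2 * real (ht x) + (real D - (real n - 1)))"
    by (intro sum.cong refl) (simp add: sum_degreeG_dist)
  also have "\<dots> = 2 * W + 2 * H + real n * (real D - (real n - 1))"
    by (simp add: sum.distrib sum_distrib_left[symmetric] W_def H_def gdist_sym)
  finally show ?thesis
    unfolding sum_degreeG_ht sum_degreeG by (simp add: algebra_simps)
qed

text \<open>The factor clears the denominators \<open>4 * n\<close> and \<open>n - 1\<close>. The
  total distance has coefficient \<open>4 * (n - 1)\<close> from \<open>G\<close> and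
  \<open>4 * n\<close> from the tree, which leaves \<open>- 4 * W\<close>.\<close>

lemma kemeny_diff:
  "(kemeny n G - kemeny n E) * (4 * real n * (real n - 1)) =
    (real n - 1) * (4 * real n * real D + 2 * real D + 2) + 8 * (real n - 1) * H - 4 * W
      - 4 * (real n - 1) * S2 / (real D + 1)"
proof -
  define Q where "Q = (\<Sum>x<n. \<Sum>y<n. degG x * degG y * res x y)"
  have Q: "Q = 4 * W + 8 * H + 4 * real n * (real D - real n + 1) + 2 * real D - 2 * (real n - 1)
      - 4 * S2 / (real D + 1)"
    unfolding Q_def res_def
    using sum_degreeG_dist_degreeG sum_degreeG_base_sq
    by (simp add: right_diff_distrib sum_subtractf sum_divide_distrib[symmetric])
  have n: "real n - 1 > 0" "real n > 0" using n_gt_1 by auto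
  have "kemeny n G * (4 * real n * (real n - 1)) = (real n - 1) * Q"
    unfolding kemeny_chord Q_def[symmetric] using n by simp
  moreover have "kemeny n E * (4 * real n * (real n - 1)) =
      4 * real n * W - 2 * real n * (real n - 1) * (2 * real n - 1)"
    unfolding kemeny_tree[OF n_gt_1] W_def[symmetric] using n by (simp add: field_simps)
  ultimately show ?thesis unfolding Q by (simp add: algebra_simps)
qed

text \<open>Once \<open>B\<close> corrects the diagonal, each height counts for \<open>n - 1\<close>
  partners in either position. The coefficient \<open>2 * (n - 1)\<close> is exactly the one for
  which \<open>H\<close> disappears from \<open>kemeny_diff\<close>.\<close>

lemma W_le: "W \<le> S1 + 2 * (real n - 1) * H"
  and W_eq: "(\<forall>x<n. ht x \<le> 1) \<Longrightarrow> W = S1 + 2 * (real n - 1) * H"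
proof -
  define B where "B = (\<lambda>x y. \<bar>bs x - bs y\<bar> + real (ht x) + real (ht y) - (if x = y then 2 * real (ht x) else 0))"
  have B: "(\<Sum>x<n. \<Sum>y<n. B x y) = S1 + 2 * (real n - 1) * H"
    by (simp add: B_def sum.distrib sum_subtractf S1_def H_def sum_distrib_left[symmetric] algebra_simps)
  show "W \<le> S1 + 2 * (real n - 1) * H"
    unfolding W_def B[symmetric]
  proof (intro sum_mono)
    fix x y assume "x \<in> {..<n}" "y \<in> {..<n}"
    then show "rho x y \<le> B x y" using dist_le[of x y] by (auto simp: B_def)
  qed
  show "W = S1 + 2 * (real n - 1) * H" if "\<forall>x<n. ht x \<le> 1"
    unfolding W_def B[symmetric]
  proof (intro sum.cong refl)
    fix x y assume "x \<in> {..<n}" "y \<in> {..<n}"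
    then show "rho x y = B x y" using dist_eq[OF that, of x y] by (cases "x = y") (auto simp: B_def)
  qed
qed

lemma kemeny_diff_ge:
  "(kemeny n G - kemeny n E) * (4 * real n * (real n - 1)) \<ge>
    (real n - 1) * (4 * real n * real D + 2 * real D + 2) - 4 * S1 - 4 * (real n - 1) * S2 / (real D + 1)"
  unfolding kemeny_diff using W_le by (simp add: algebra_simps)

lemma kemeny_diff_eq:
  assumes "\<forall>x<n. ht x \<le> 1"
  shows "(kemeny n G - kemeny n E) * (4 * real n * (real n - 1)) =
    (real n - 1) * (4 * real n * real D + 2 * real D + 2) - 4 * S1 - 4 * (real n - 1) * S2 / (real D + 1)"
  unfolding kemeny_diff using W_eq[OF assms] by (simp add: algebra_simps)

end

section \<open>Maximal spread of levels\<close>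

definition abs_spread :: "nat \<Rightarrow> (nat \<Rightarrow> nat) \<Rightarrow> real" where
  "abs_spread n b = (\<Sum>x<n. \<Sum>y<n. \<bar>real (b x) - real (b y)\<bar>)"

definition sq_spread :: "nat \<Rightarrow> (nat \<Rightarrow> nat) \<Rightarrow> real" where
  "sq_spread n b = (\<Sum>x<n. \<Sum>y<n. (real (b x) - real (b y))\<^sup>2)"

section \<open>Cut and variance formulas for the spreads\<close>

lemma nat_diff_cuts:
  assumes "b \<le> D"
  shows "(\<Sum>k\<in>{1..D}. of_bool (a < k) * (1 - of_bool (b < k))) = real (b - a)"
proof -
  have "(\<Sum>k\<in>{1..D}. of_bool (a < k) * (1 - of_bool (b < k))) = (\<Sum>k\<in>{1..D}. of_bool (k \<in> {a<..b}) :: real)"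
    by (intro sum.cong refl) auto
  also have "\<dots> = real (card ({1..D} \<inter> {a<..b}))"
    by (simp only: sum_of_bool_eq finite_atLeastAtMost Collect_mem_eq)
  also have "{1..D} \<inter> {a<..b} = {a<..b}" using assms by auto
  finally show ?thesis by simp
qed

lemma abs_diff_cuts:
  assumes "a \<le> D" "b \<le> D"
  shows "\<bar>real a - real b\<bar> = (\<Sum>k\<in>{1..D}. of_bool (a < k) * (1 - of_bool (b < k)) + of_bool (b < k) * (1 - of_bool (a < k)))"
  unfolding sum.distrib nat_diff_cuts[OF assms(1)] nat_diff_cuts[OF assms(2)] by auto

text \<open>Two levels differ by the number of thresholds \<open>k\<close> that separate them, and a
  threshold with \<open>L\<close> elements below it separates \<open>2 * L * (n - L)\<close> ordered
  pairs.\<close>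

lemma abs_spread_cuts:
  assumes "\<And>x. x < n \<Longrightarrow> b x \<le> D"
  shows "abs_spread n b = (\<Sum>k\<in>{1..D}. 2 * real (card {x. x < n \<and> b x < k}) * (real n - real (card {x. x < n \<and> b x < k})))"
proof -
  define L :: "nat \<Rightarrow> real" where "L = (\<lambda>k. \<Sum>x<n. of_bool (b x < k))"
  have L: "L k = real (card {x. x < n \<and> b x < k})" for k
    unfolding L_def by (subst sum_of_bool_eq) (auto intro!: arg_cong[of _ _ card])
  have "abs_spread n b = (\<Sum>x<n. \<Sum>y<n. \<Sum>k\<in>{1..D}. of_bool (b x < k) * (1 - of_bool (b y < k)) + of_bool (b y < k) * (1 - of_bool (b x < k)))"
    unfolding abs_spread_def using assms by (intro sum.cong refl abs_diff_cuts) auto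
  also have "\<dots> = (\<Sum>k\<in>{1..D}. \<Sum>x<n. \<Sum>y<n. of_bool (b x < k) * (1 - of_bool (b y < k)) + of_bool (b y < k) * (1 - of_bool (b x < k)))"
    by (simp only: sum.swap[of _ "{1..D}"])
  also have "\<dots> = (\<Sum>k\<in>{1..D}. 2 * L k * (real n - L k))"
  proof (rule sum.cong[OF refl])
    fix k
    have "(\<Sum>x<n. \<Sum>y<n. of_bool (b x < k) * (1 - of_bool (b y < k)) + of_bool (b y < k) * (1 - of_bool (b x < k))) =
        (\<Sum>x<n. of_bool (b x < k) * (real n - L k) + L k * (1 - of_bool (b x < k)))"
      unfolding L_def by (simp add: sum.distrib sum_subtractf sum_distrib_left[symmetric] sum_distrib_right[symmetric])
    also have "\<dots> = L k * (real n - L k) + L k * (real n - L k)"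
      unfolding sum.distrib sum_distrib_left[symmetric] sum_distrib_right[symmetric] sum_subtractf
      by (simp add: L_def)
    finally show "(\<Sum>x<n. \<Sum>y<n. of_bool (b x < k) * (1 - of_bool (b y < k)) + of_bool (b y < k) * (1 - of_bool (b x < k))) = 2 * L k * (real n - L k)"
      by simp
  qed
  finally show ?thesis by (simp add: L)
qed

lemma sum_centered_sq: "(\<Sum>i\<le>D. (2 * real i - real D)\<^sup>2) = real D * (real D + 1) * (real D + 2) / 3"
proof -
  \<comment> \<open>The centre is generalised to \<open>a\<close>, since otherwise it would move
    with \<open>D\<close> during the induction.\<close>
  have "(\<Sum>i\<le>D. (2 * real i - a)\<^sup>2) =
      2 * real D * (real D + 1) * (2 * real D + 1) / 3 - 2 * a * real D * (real D + 1) + a\<^sup>2 * (real D + 1)" for a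
    by (induction D) (auto simp: field_simps power2_eq_square)
  from this[of "real D"] show ?thesis by (simp add: field_simps power2_eq_square)
qed

lemma sum_centered: "(\<Sum>i\<le>D. 2 * real i - real D) = 0"
proof -
  have "(\<Sum>i\<le>D. 2 * real i - a) = (real D + 1) * (real D - a)" for a
    by (induction D) (auto simp: algebra_simps)
  then show ?thesis by simp
qed

lemma sum_cut_sq:
  assumes "D \<ge> 1"
  shows "(\<Sum>k\<in>{1..D}. (2 * real k - (real D + 1))\<^sup>2) = (real D - 1) * real D * (real D + 1) / 3"
proof -
  have "(\<Sum>k\<in>{1..D}. (2 * real k - (real D + 1))\<^sup>2) = (\<Sum>i\<le>D - 1. (2 * real (Suc i) - (real D + 1))\<^sup>2)"
    using assms by (intro sum.reindex_bij_witness[of _ Suc "\<lambda>k. k - 1"]) auto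
  also have "\<dots> = (\<Sum>i\<le>D - 1. (2 * real i - real (D - 1))\<^sup>2)"
    using assms by (intro sum.cong refl) (simp add: of_nat_diff algebra_simps)
  finally show ?thesis unfolding sum_centered_sq using assms by (simp add: of_nat_diff)
qed

text \<open>The variance formula about an arbitrary centre. Doubling the levels, at the cost of the
  factor 4, makes the midpoint of the path the integer \<open>a = D\<close>.\<close>

lemma sq_spread_centered:
  "4 * sq_spread n b = 2 * real n * (\<Sum>x<n. (2 * real (b x) - a)\<^sup>2) - 2 * (\<Sum>x<n. 2 * real (b x) - a)\<^sup>2"
proof -
  define t where "t = (\<lambda>x. 2 * real (b x) - a)"
  have "4 * sq_spread n b = (\<Sum>x<n. \<Sum>y<n. (t x)\<^sup>2 + (t y)\<^sup>2 - 2 * (t x * t y))"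
    unfolding sq_spread_def sum_distrib_left
    by (intro sum.cong refl) (simp add: t_def power2_eq_square algebra_simps)
  also have "\<dots> = 2 * real n * (\<Sum>x<n. (t x)\<^sup>2) - 2 * ((\<Sum>x<n. t x) * (\<Sum>x<n. t x))"
    by (simp add: sum.distrib sum_subtractf sum_distrib_left[symmetric] sum_product)
  finally show ?thesis by (simp add: t_def power2_eq_square)
qed

section \<open>The most spread-out assignment of levels\<close>

locale path_levels =
  fixes n D :: nat and b :: "nat \<Rightarrow> nat"
  assumes D: "2 \<le> D" and b_le: "\<And>x. x < n \<Longrightarrow> b x \<le> D"
    and b_surj: "\<And>i. i \<le> D \<Longrightarrow> \<exists>x<n. b x = i"
begin

text \<open>Equals 1 when the \<open>n - (D + 1)\<close> surplus elements, those beyond one per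
  level, cannot be split evenly between the two ends.\<close>

abbreviation par :: real where "par \<equiv> of_bool (odd (n - Suc D))"

lemma representatives:
  obtains g where "inj_on g {..D}" "\<And>i. i \<le> D \<Longrightarrow> g i < n" "\<And>i. i \<le> D \<Longrightarrow> b (g i) = i"
    "card ({..<n} - g ` {..D}) = n - Suc D" "Suc D \<le> n"
proof -
  from b_surj obtain g where g: "\<And>i. i \<le> D \<Longrightarrow> g i < n" "\<And>i. i \<le> D \<Longrightarrow> b (g i) = i" by metis
  have inj: "inj_on g {..D}" by (rule inj_onI) (metis atMost_iff g(2))
  have sub: "g ` {..D} \<subseteq> {..<n}" using g by auto
  then have "Suc D \<le> n" using card_mono[OF _ sub] inj by (simp add: card_image)
  moreover have "card ({..<n} - g ` {..D}) = n - Suc D"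
    using inj sub by (simp add: card_Diff_subset card_image)
  ultimately show ?thesis using that[of g] inj g by blast
qed

lemma D_less: "Suc D \<le> n" using representatives by blast

text \<open>One representative per level makes a fixed contribution; \<open>R\<close> is the
  surplus.\<close>

lemma sum_split:
  obtains R where "finite R" "R \<subseteq> {..<n}" "card R = n - Suc D"
    and "\<And>\<phi> :: nat \<Rightarrow> real. (\<Sum>x<n. \<phi> (b x)) = (\<Sum>i\<le>D. \<phi> i) + (\<Sum>x\<in>R. \<phi> (b x))"
proof -
  obtain g where g: "inj_on g {..D}" "\<And>i. i \<le> D \<Longrightarrow> g i < n" "\<And>i. i \<le> D \<Longrightarrow> b (g i) = i"
    "card ({..<n} - g ` {..D}) = n - Suc D" using representatives by metis
  have "(\<Sum>x<n. \<phi> (b x)) = (\<Sum>i\<le>D. \<phi> i) + (\<Sum>x\<in>{..<n} - g ` {..D}. \<phi> (b x))" for \<phi> :: "nat \<Rightarrow> real"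
  proof -
    have "(\<Sum>x<n. \<phi> (b x)) = (\<Sum>x\<in>{..<n} - g ` {..D}. \<phi> (b x)) + (\<Sum>x\<in>g ` {..D}. \<phi> (b x))"
      using g by (intro sum.subset_diff) auto
    then show ?thesis using g by (simp add: sum.reindex)
  qed
  then show ?thesis using that[of "{..<n} - g ` {..D}"] g(4) by blast
qed

text \<open>Each surplus element contributes most at an end of the path, and the sum of the
  \<open>t x\<close> should vanish. An odd surplus loses something: either all of it lies at the
  ends and that sum is an odd multiple of \<open>D\<close>, or an interior element lowers the sum of
  squares.\<close>

lemma sq_spread_le:
  "4 * sq_spread n b \<le> 2 * real n * (real D * (real D + 1) * (real D + 2) / 3 + real (n - Suc D) * (real D)\<^sup>2)
    - 2 * par * (real D)\<^sup>2"
proof -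
  obtain R where R: "finite R" "R \<subseteq> {..<n}" "card R = n - Suc D"
    and split: "\<And>\<phi> :: nat \<Rightarrow> real. (\<Sum>x<n. \<phi> (b x)) = (\<Sum>i\<le>D. \<phi> i) + (\<Sum>x\<in>R. \<phi> (b x))"
    using sum_split by metis
  define t where "t = (\<lambda>x. 2 * real (b x) - real D)"
  have t2: "(t x)\<^sup>2 \<le> (real D)\<^sup>2" if "x \<in> R" for x
    using b_le[of x] that R(2) by (intro abs_le_square_iff[THEN iffD1]) (auto simp: t_def)
  have eq: "4 * sq_spread n b = 2 * real n * (real D * (real D + 1) * (real D + 2) / 3 + (\<Sum>x\<in>R. (t x)\<^sup>2))
      - 2 * (\<Sum>x\<in>R. t x)\<^sup>2"
    unfolding sq_spread_centered[of n b "real D"] split[of "\<lambda>i. (2 * real i - real D)\<^sup>2"]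
      split[of "\<lambda>i. 2 * real i - real D"] sum_centered sum_centered_sq t_def by simp
  have le: "(\<Sum>x\<in>R. (t x)\<^sup>2) \<le> real (n - Suc D) * (real D)\<^sup>2"
    using sum_bounded_above[of R "\<lambda>x. (t x)\<^sup>2" "(real D)\<^sup>2"] t2 R(3) by simp
  have key: "real n * (\<Sum>x\<in>R. (t x)\<^sup>2) - (\<Sum>x\<in>R. t x)\<^sup>2 \<le> real n * (real (n - Suc D) * (real D)\<^sup>2) - par * (real D)\<^sup>2"
  proof (cases "odd (n - Suc D)")
    case False
    have "real n * (\<Sum>x\<in>R. (t x)\<^sup>2) \<le> real n * (real (n - Suc D) * (real D)\<^sup>2)"
      using le by (intro mult_left_mono) auto
    moreover have p: "par = 0" using False by simp
    ultimately show ?thesis unfolding p using zero_le_power2[of "\<Sum>x\<in>R. t x"] by linarith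
  next
    case odd: True
    have p: "par = 1" using odd by simp
    show ?thesis
    proof (cases "\<forall>x\<in>R. b x = 0 \<or> b x = D")
      case True
      define P where "P = {x \<in> R. b x = D}"
      have "t x = real D * (2 * of_bool (b x = D) - 1)" if "x \<in> R" for x
        using True that D by (auto simp: t_def)
      then have "(\<Sum>x\<in>R. t x) = (\<Sum>x\<in>R. real D * (2 * of_bool (b x = D) - 1))"
        by (intro sum.cong refl) auto
      also have "\<dots> = real D * (2 * real (card P) - real (card R))"
        using R(1) by (simp add: sum_distrib_left[symmetric] sum_subtractf sum_of_bool_eq P_def Int_def)
      also have "2 * real (card P) - real (card R) = of_int (2 * int (card P) - int (card R))" by simp
      finally have s: "(\<Sum>x\<in>R. t x)\<^sup>2 = (real D)\<^sup>2 * of_int ((2 * int (card P) - int (card R))\<^sup>2)"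
        by (simp add: power_mult_distrib)
      have "odd (int (card R))" using odd R(3) by simp
      then have "2 * int (card P) - int (card R) \<noteq> 0" by presburger
      then have "(2 * int (card P) - int (card R))\<^sup>2 > 0" by simp
      then have "(1::real) \<le> of_int ((2 * int (card P) - int (card R))\<^sup>2)" by linarith
      then have "(real D)\<^sup>2 * 1 \<le> (\<Sum>x\<in>R. t x)\<^sup>2"
        unfolding s by (intro mult_left_mono) auto
      moreover have "real n * (\<Sum>x\<in>R. (t x)\<^sup>2) \<le> real n * (real (n - Suc D) * (real D)\<^sup>2)"
        using le by (intro mult_left_mono) auto
      ultimately show ?thesis unfolding p by simp
    next
      case False
      \<comment> \<open>An interior surplus element loses at least
        \<open>D\<^sup>2 - (D - 2)\<^sup>2 = 4 * (D - 1)\<close>, and with the factor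
        \<open>n \<ge> D + 1\<close> this exceeds \<open>D\<^sup>2\<close>.\<close>
      then obtain z where z: "z \<in> R" "b z \<noteq> 0" "b z \<noteq> D" by blast
      have "b z \<ge> 1 \<and> b z \<le> D - 1" using z b_le[of z] R(2) by fastforce
      then have "\<bar>t z\<bar> \<le> \<bar>real D - 2\<bar>" using D by (auto simp: t_def)
      then have tz: "(t z)\<^sup>2 \<le> (real D - 2)\<^sup>2" by (rule abs_le_square_iff[THEN iffD1])
      have "(\<Sum>x\<in>R. (t x)\<^sup>2) = (t z)\<^sup>2 + (\<Sum>x\<in>R - {z}. (t x)\<^sup>2)"
        using z R(1) by (simp add: sum.remove)
      also have "(\<Sum>x\<in>R - {z}. (t x)\<^sup>2) \<le> real (card (R - {z})) * (real D)\<^sup>2"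
        using t2 by (intro sum_bounded_above) auto
      also have "real (card (R - {z})) = real (n - Suc D) - 1"
        using z(1) R card_gt_0_iff[of R] by (auto simp: of_nat_diff Suc_leI)
      finally have "(\<Sum>x\<in>R. (t x)\<^sup>2) \<le> real (n - Suc D) * (real D)\<^sup>2 - 4 * (real D - 1)"
        using tz by (simp add: power2_eq_square algebra_simps)
      then have "real n * (\<Sum>x\<in>R. (t x)\<^sup>2) \<le> real n * (real (n - Suc D) * (real D)\<^sup>2 - 4 * (real D - 1))"
        by (rule mult_left_mono) simp
      moreover have "(real D)\<^sup>2 \<le> real n * (4 * (real D - 1))"
      proof -
        have "(real D + 1) * (4 * (real D - 1)) \<le> real n * (4 * (real D - 1))"
          using D_less D by (intro mult_right_mono) auto
        moreover have "2 * 2 \<le> real D * real D" using D by (intro mult_mono) auto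
        ultimately show ?thesis by (simp add: power2_eq_square algebra_simps)
      qed
      ultimately show ?thesis unfolding p using zero_le_power2[of "\<Sum>x\<in>R. t x"] by (simp only: right_diff_distrib)
    qed
  qed
  show ?thesis unfolding eq using key by (simp add: algebra_simps)
qed

text \<open>With \<open>L\<close> elements below threshold \<open>k\<close>,
  \<open>4 * L * (n - L) = n\<^sup>2 - (2 * L - n)\<^sup>2\<close>, and \<open>2 * L - n\<close>
  splits into \<open>2 * k - c\<close> from the path and \<open>2 * z k - N\<close> from the
  surplus. The second square is at least \<open>par\<close>, and the cross terms sum to something
  nonnegative.\<close>

lemma abs_spread_le:
  "2 * abs_spread n b \<le> real D * (real n)\<^sup>2 - (real D - 1) * real D * (real D + 1) / 3 - par * real D"
proof -
  define c where "c = Suc D"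
  define L where "L = (\<lambda>k. card {x. x < n \<and> b x < k})"
  define N where "N = n - c"
  have step: "Suc (L k) \<le> L (Suc k)" if "k \<le> D" for k
  proof -
    obtain x where x: "x < n" "b x = k" using b_surj[OF \<open>k \<le> D\<close>] by blast
    have "insert x {x. x < n \<and> b x < k} \<subseteq> {x. x < n \<and> b x < Suc k}" using x by auto
    then have "card (insert x {x. x < n \<and> b x < k}) \<le> L (Suc k)"
      unfolding L_def by (intro card_mono) auto
    then show ?thesis using x by (simp add: L_def)
  qed
  have steps: "L i + (j - i) \<le> L j" if "i \<le> j" "j \<le> Suc D" for i j
    using that
  proof (induction j)
    case (Suc j)
    then show ?case using step[of j] by (cases "i = Suc j") auto
  qed simp
  have L0: "L 0 = 0" by (simp add: L_def)
  have "{x. x < n \<and> b x < c} = {..<n}" using b_le by (fastforce simp: c_def)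
  then have Lc: "L c = n" by (simp add: L_def)
  \<comment> \<open>The number of surplus elements below threshold \<open>k\<close>, which grows
    with \<open>k\<close>.\<close>
  define z where "z = (\<lambda>k. real (L k) - real k)"
  have z_mono: "z i \<le> z j" if "i \<le> j" "j \<le> D" for i j
    using steps[of i j] that by (simp add: z_def)
  have nN: "real n = real c + real N" using D_less by (simp add: N_def c_def of_nat_diff)
  have par: "par \<le> (2 * z k - real N)\<^sup>2" for k
  proof (cases "odd (n - Suc D)")
    case True
    have "2 * z k - real N = of_int (2 * (int (L k) - int k) - int N)" by (simp add: z_def)
    moreover have "odd (int N)" using True by (simp add: N_def c_def)
    then have "2 * (int (L k) - int k) - int N \<noteq> 0" by presburger
    then have "(2 * (int (L k) - int k) - int N)\<^sup>2 > 0" by simp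
    then have "(1::real) \<le> of_int ((2 * (int (L k) - int k) - int N)\<^sup>2)" by linarith
    ultimately show ?thesis using True by simp
  qed simp
  \<comment> \<open>Chebyshev's argument: both factors increase with \<open>k\<close>, and
    reflecting \<open>k\<close> to \<open>c - k\<close> changes the sign of the first, so adding the
    reflected sum leaves products of factors of equal sign.\<close>
  have cross: "0 \<le> (\<Sum>k\<in>{1..D}. (2 * real k - real c) * (2 * z k - real N))" (is "0 \<le> ?C")
  proof -
    have "?C = (\<Sum>k\<in>{1..D}. (2 * real (c - k) - real c) * (2 * z (c - k) - real N))"
      by (rule sum.reindex_bij_witness[of _ "\<lambda>k. c - k" "\<lambda>k. c - k"]) (auto simp: c_def)
    also have "\<dots> = (\<Sum>k\<in>{1..D}. - (2 * real k - real c) * (2 * z (c - k) - real N))"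
      by (intro sum.cong refl) (auto simp: c_def of_nat_diff algebra_simps)
    finally have C: "?C = (\<Sum>k\<in>{1..D}. - (2 * real k - real c) * (2 * z (c - k) - real N))" (is "_ = ?C'") .
    have "?C + ?C' = (\<Sum>k\<in>{1..D}. (2 * real k - real c) * (2 * (z k - z (c - k))))"
      unfolding sum.distrib[symmetric] by (intro sum.cong refl) (simp add: algebra_simps)
    also have "\<dots> \<ge> 0"
    proof (rule sum_nonneg)
      fix k assume k: "k \<in> {1..D}"
      show "0 \<le> (2 * real k - real c) * (2 * (z k - z (c - k)))"
      proof (cases "k \<le> c - k")
        case True
        then show ?thesis using z_mono[of k "c - k"] k by (intro mult_nonpos_nonpos) (auto simp: c_def)
      next
        case False
        then show ?thesis using z_mono[of "c - k" k] k by (intro mult_nonneg_nonneg) (auto simp: c_def)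
      qed
    qed
    finally show ?thesis unfolding C[symmetric] by simp
  qed
  have "2 * abs_spread n b = (\<Sum>k\<in>{1..D}. 4 * real (L k) * (real n - real (L k)))"
    using abs_spread_cuts[of n b D] b_le by (simp add: L_def sum_distrib_left mult_ac)
  also have "\<dots> = (\<Sum>k\<in>{1..D}. (real n)\<^sup>2 - (2 * real k - real c)\<^sup>2 - (2 * z k - real N)\<^sup>2
      - 2 * ((2 * real k - real c) * (2 * z k - real N)))"
    by (intro sum.cong refl) (simp add: z_def nN power2_eq_square algebra_simps)
  also have "\<dots> = real D * (real n)\<^sup>2 - (\<Sum>k\<in>{1..D}. (2 * real k - real c)\<^sup>2) - (\<Sum>k\<in>{1..D}. (2 * z k - real N)\<^sup>2) - 2 * ?C"
    by (simp add: sum_subtractf sum_distrib_left)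
  also have "(\<Sum>k\<in>{1..D}. (2 * real k - real c)\<^sup>2) = (real D - 1) * real D * (real D + 1) / 3"
    using sum_cut_sq[of D] D by (simp add: c_def add.commute)
  finally have "2 * abs_spread n b = real D * (real n)\<^sup>2 - (real D - 1) * real D * (real D + 1) / 3 - (\<Sum>k\<in>{1..D}. (2 * z k - real N)\<^sup>2) - 2 * ?C" .
  moreover have "par * real D \<le> (\<Sum>k\<in>{1..D}. (2 * z k - real N)\<^sup>2)"
    using sum_bounded_below[of "{1..D}" par "\<lambda>k. (2 * z k - real N)\<^sup>2"] par by (simp add: mult.commute)
  ultimately show ?thesis using cross by linarith
qed

text \<open>Half of the surplus, rounded down, sits at 0 and the rest at \<open>D\<close>, so
  \<open>k + A\<close> elements lie below each threshold \<open>k\<close>. In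
  \<open>abs_spread_le\<close> the surplus term is then constantly \<open>- par\<close>, and the
  cross terms sum to zero by symmetry.\<close>

lemma spread_balanced:
  assumes ends: "\<And>x. x < n \<Longrightarrow> x > D \<Longrightarrow> b x = (if x \<le> D + (n - Suc D) div 2 then 0 else D)"
    and path: "\<And>x. x \<le> D \<Longrightarrow> b x = x"
  shows "2 * abs_spread n b = real D * (real n)\<^sup>2 - (real D - 1) * real D * (real D + 1) / 3 - par * real D"
    and "4 * sq_spread n b = 2 * real n * (real D * (real D + 1) * (real D + 2) / 3 + real (n - Suc D) * (real D)\<^sup>2)
      - 2 * par * (real D)\<^sup>2"
proof -
  define N where "N = n - Suc D"
  define A where "A = N div 2"
  have n: "n = Suc D + N" using D_less by (simp add: N_def)
  have A: "2 * real A = real N - par"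
    unfolding A_def N_def[symmetric] by (cases "odd N") (auto simp: real_of_nat_div elim!: oddE evenE)
  have L: "card {x. x < n \<and> b x < k} = k + A" if "k \<in> {1..D}" for k
  proof -
    have "{x. x < n \<and> b x < k} = {..<k} \<union> {D<..D + A}"
    proof (rule set_eqI)
      fix x
      show "x \<in> {x. x < n \<and> b x < k} \<longleftrightarrow> x \<in> {..<k} \<union> {D<..D + A}"
      proof (cases "x \<le> D")
        case True
        then show ?thesis using path[of x] n by auto
      next
        case False
        have "D + A < n" using n by (simp add: A_def)
        then show ?thesis using False ends[of x] that
          by (cases "x \<le> D + A") (auto simp: A_def N_def)
      qed
    qed
    moreover have "{..<k} \<inter> {D<..D + A} = {}" using that by auto
    ultimately show ?thesis by (simp add: card_Un_disjoint)
  qed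
  have cuts: "abs_spread n b = (\<Sum>k\<in>{1..D}. 2 * real (card {x. x < n \<and> b x < k}) * (real n - real (card {x. x < n \<and> b x < k})))"
    using b_le by (rule abs_spread_cuts)
  have "2 * abs_spread n b = (\<Sum>k\<in>{1..D}. 4 * real (k + A) * (real n - real (k + A)))"
    unfolding cuts sum_distrib_left by (intro sum.cong refl) (simp add: L)
  also have "\<dots> = (\<Sum>k\<in>{1..D}. (real n)\<^sup>2 - (2 * real k - (real D + 1))\<^sup>2 + 2 * par * (2 * real k - (real D + 1)) - par)"
  proof (intro sum.cong refl)
    fix k
    define e where "e = par"
    have N: "real N = 2 * real A + e" using A by (simp add: e_def)
    have ee: "e * e = e" unfolding e_def of_bool_conj[symmetric] by simp
    show "4 * real (k + A) * (real n - real (k + A)) =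
      (real n)\<^sup>2 - (2 * real k - (real D + 1))\<^sup>2 + 2 * par * (2 * real k - (real D + 1)) - par"
      unfolding e_def[symmetric] by (simp add: n N power2_eq_square algebra_simps ee)
  qed
  also have "\<dots> = real D * (real n)\<^sup>2 - (\<Sum>k\<in>{1..D}. (2 * real k - (real D + 1))\<^sup>2) + 2 * par * (\<Sum>k\<in>{1..D}. 2 * real k - (real D + 1)) - par * real D"
    by (simp add: sum.distrib sum_subtractf sum_distrib_left)
  also have "(\<Sum>k\<in>{1..D}. 2 * real k - (real D + 1)) = 0"
  proof -
    have "(\<Sum>k\<in>{1..m}. 2 * real k - a) = real m * (real m + 1 - a)" for a m
      by (induction m) (auto simp: algebra_simps)
    then show ?thesis by simp
  qed
  finally show "2 * abs_spread n b = real D * (real n)\<^sup>2 - (real D - 1) * real D * (real D + 1) / 3 - par * real D"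
    using sum_cut_sq[of D] D by simp
  have AN: "A \<le> N" by (simp add: A_def)
  have low: "b x = 0" if "x \<in> {D<..D + A}" for x
    using that ends[of x] n AN by (simp add: A_def[symmetric] N_def[symmetric])
  have high: "b x = D" if "x \<in> {D + A<..D + N}" for x
    using that ends[of x] n AN by (simp add: A_def[symmetric] N_def[symmetric])
  have split: "(\<Sum>x<n. \<phi> (b x)) = (\<Sum>i\<le>D. \<phi> i) + real A * \<phi> 0 + real (N - A) * \<phi> D" for \<phi> :: "nat \<Rightarrow> real"
  proof -
    have "{..<n} = {..D} \<union> {D<..D + A} \<union> {D + A<..D + N}" using n by (auto simp: A_def)
    then have "(\<Sum>x<n. \<phi> (b x)) = (\<Sum>x\<in>{..D}. \<phi> (b x)) + (\<Sum>x\<in>{D<..D + A}. \<phi> (b x)) + (\<Sum>x\<in>{D + A<..D + N}. \<phi> (b x))"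
      by (simp add: sum.union_disjoint disjoint_iff)
    moreover have "(\<Sum>x\<in>{..D}. \<phi> (b x)) = (\<Sum>i\<le>D. \<phi> i)" using path by simp
    moreover have "(\<Sum>x\<in>{D<..D + A}. \<phi> (b x)) = (\<Sum>x\<in>{D<..D + A}. \<phi> 0)"
      using low by (intro sum.cong refl) simp
    moreover have "(\<Sum>x\<in>{D + A<..D + N}. \<phi> (b x)) = (\<Sum>x\<in>{D + A<..D + N}. \<phi> D)"
      using high by (intro sum.cong refl) simp
    ultimately show ?thesis by simp
  qed
  have NA: "real (N - A) = real N - real A" by (simp add: A_def of_nat_diff)
  have sq: "(\<Sum>x<n. (2 * real (b x) - real D)\<^sup>2) = real D * (real D + 1) * (real D + 2) / 3 + real N * (real D)\<^sup>2"
    unfolding split[of "\<lambda>i. (2 * real i - real D)\<^sup>2"] sum_centered_sq NA by (simp add: algebra_simps)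
  have lin: "(\<Sum>x<n. 2 * real (b x) - real D) = par * real D"
  proof -
    have "(\<Sum>x<n. 2 * real (b x) - real D) = (real N - 2 * real A) * real D"
      unfolding split[of "\<lambda>i. 2 * real i - real D"] sum_centered NA by (simp add: algebra_simps)
    also have "real N - 2 * real A = par" using A by linarith
    finally show ?thesis .
  qed
  have par_sq: "par\<^sup>2 = par" unfolding power2_eq_square of_bool_conj[symmetric] by simp
  show "4 * sq_spread n b = 2 * real n * (real D * (real D + 1) * (real D + 2) / 3 + real (n - Suc D) * (real D)\<^sup>2)
      - 2 * par * (real D)\<^sup>2"
    unfolding sq_spread_centered[of n b "real D"] sq lin N_def power_mult_distrib par_sq by simp
qed

end

section \<open>The change of Kemeny's constant for a given cycle length\<close>

text \<open>For \<open>c \<le> n\<close> the parity of \<open>n + c\<close> is that of the surplus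
  \<open>n - c\<close>, without truncated subtraction.\<close>

definition cycle_value :: "nat \<Rightarrow> nat \<Rightarrow> real" where
  "cycle_value n c = (if even (n + c) then f_e n (real c) else f_o n (real c))"

text \<open>\<open>s1\<close> and \<open>s2\<close> stand for the extremal spreads, so that the
  identity serves both the lower bound and the extremal tree. The factors 2 and 3 pass from
  \<open>4 * n * (n - 1)\<close> to \<open>6 * n * (n - 1)\<close>.\<close>

lemma cycle_value_spread:
  assumes "Suc D \<le> n"
    and "2 * s1 = real D * (real n)\<^sup>2 - (real D - 1) * real D * (real D + 1) / 3 - of_bool (odd (n - Suc D)) * real D"
    and "4 * s2 = 2 * real n * (real D * (real D + 1) * (real D + 2) / 3 + real (n - Suc D) * (real D)\<^sup>2)
      - 2 * of_bool (odd (n - Suc D)) * (real D)\<^sup>2"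
  shows "2 * cycle_value n (Suc D) =
    3 * ((real n - 1) * (4 * real n * real D + 2 * real D + 2) - 4 * s1 - 4 * (real n - 1) * s2 / (real D + 1))"
proof -
  define e :: real where "e = of_bool (odd (n - Suc D))"
  define c where "c = real D + 1"
  have c: "c > 0" "real D = c - 1" by (auto simp: c_def)
  have n: "real (n - Suc D) = real n - c" using assms(1) by (simp add: of_nat_diff c_def)
  have par: "odd (n - Suc D) \<longleftrightarrow> odd (n + Suc D)" using assms(1) by simp
  \<comment> \<open>The indicator \<open>e\<close> merges the two parities: its coefficient is
    \<open>f_o - f_e\<close>.\<close>
  have fe: "cycle_value n (Suc D) = f_e n c + e * (3 * real n * c - 6 * real n + 3 + (3 * real n - 3) / c)"
    unfolding cycle_value_def e_def par using c(1)
    by (simp add: f_e_def f_o_def Let_def c_def[symmetric] add.commute[of 1] diff_divide_distrib add_divide_distrib)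
      (simp add: algebra_simps)
  have s1: "4 * s1 = 2 * (c - 1) * (real n)\<^sup>2 - 2 * (c - 2) * (c - 1) * c / 3 - 2 * e * (c - 1)"
    using assms(2) unfolding e_def[symmetric] c(2) by (simp add: field_simps)
  have s2: "4 * s2 = 2 * real n * ((c - 1) * c * (c + 1) / 3 + (real n - c) * (c - 1)\<^sup>2) - 2 * e * (c - 1)\<^sup>2"
    using assms(3) unfolding e_def[symmetric] n c(2) by (simp add: field_simps)
  \<comment> \<open>Treating \<open>1 / c\<close> as a variable with \<open>c * i = 1\<close> makes
    the identity polynomial.\<close>
  define i where "i = 1 / c"
  have i: "x / c = x * i" for x by (simp add: i_def)
  have ci: "c * i = 1" using c(1) by (simp add: i_def)
  have "4 * s2 / c = 2 * real n * ((c - 1) * (c + 1) / 3 * (c * i) + (real n - c) * (c * (c * i) - 2 * (c * i) + i))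
      - 2 * e * (c * (c * i) - 2 * (c * i) + i)"
    unfolding s2 i by (simp add: power2_eq_square field_simps)
  moreover have "(real n - c) * (c * 1 - 2 * 1 + i) = (real n - c) * (c - 2) + real n * i - 1"
    using ci by (simp add: algebra_simps)
  ultimately have s2c: "4 * s2 / c = 2 * real n * ((c - 1) * (c + 1) / 3 + (real n - c) * (c - 2) + real n * i - 1)
      - 2 * e * (c - 2 + i)"
    unfolding ci by simp
  have "4 * (real n - 1) * s2 / c = (real n - 1) * (4 * s2 / c)" by simp
  also have "\<dots> = (real n - 1) * (2 * real n * ((c - 1) * (c + 1) / 3 + (real n - c) * (c - 2) + real n * i - 1)
      - 2 * e * (c - 2 + i))"
    unfolding s2c by simp
  finally have s2_term: "4 * (real n - 1) * s2 / c = (real n - 1) *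
      (2 * real n * ((c - 1) * (c + 1) / 3 + (real n - c) * (c - 2) + real n * i - 1) - 2 * e * (c - 2 + i))" .
  show ?thesis
    unfolding fe c_def[symmetric] s2_term unfolding c(2) s1 f_e_def Let_def i
    by (simp add: power2_eq_square power3_eq_cube field_simps)
qed

section \<open>Lower bound and extremal trees\<close>

sublocale tree_chord \<subseteq> levels: path_levels n D base
  using D_ge_2 dist_ends(3) base_surj by unfold_locales auto

context tree_chord
begin

lemma S_spread: "S1 = abs_spread n base" "S2 = sq_spread n base"
  by (simp_all add: S1_def S2_def abs_spread_def sq_spread_def)

lemma kemeny_diff_lower:
  "cycle_value n (Suc D) \<le> (kemeny n G - kemeny n E) * (6 * real n * (real n - 1))"
proof -
  define s1 where "s1 = (real D * (real n)\<^sup>2 - (real D - 1) * real D * (real D + 1) / 3 - levels.par * real D) / 2"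
  define s2 where "s2 = (2 * real n * (real D * (real D + 1) * (real D + 2) / 3 + real (n - Suc D) * (real D)\<^sup>2)
    - 2 * levels.par * (real D)\<^sup>2) / 4"
  have "2 * cycle_value n (Suc D) =
    3 * ((real n - 1) * (4 * real n * real D + 2 * real D + 2) - 4 * s1 - 4 * (real n - 1) * s2 / (real D + 1))"
    by (rule cycle_value_spread[OF levels.D_less]) (simp_all add: s1_def s2_def)
  also have "S1 \<le> s1" "S2 \<le> s2"
    using levels.abs_spread_le levels.sq_spread_le by (simp_all add: S_spread s1_def s2_def)
  then have "(real n - 1) * (4 * real n * real D + 2 * real D + 2) - 4 * s1 - 4 * (real n - 1) * s2 / (real D + 1)
      \<le> (real n - 1) * (4 * real n * real D + 2 * real D + 2) - 4 * S1 - 4 * (real n - 1) * S2 / (real D + 1)"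
    using n_gt_1 by (intro diff_mono divide_right_mono mult_left_mono) auto
  also have "\<dots> \<le> (kemeny n G - kemeny n E) * (4 * real n * (real n - 1))"
    by (rule kemeny_diff_ge)
  finally show ?thesis by (simp add: algebra_simps)
qed

lemma kemeny_diff_balanced:
  assumes "\<And>x. x < n \<Longrightarrow> ht x \<le> 1"
    and "\<And>x. x < n \<Longrightarrow> x > D \<Longrightarrow> base x = (if x \<le> D + (n - Suc D) div 2 then 0 else D)"
    and "\<And>x. x \<le> D \<Longrightarrow> base x = x"
  shows "(kemeny n G - kemeny n E) * (6 * real n * (real n - 1)) = cycle_value n (Suc D)"
  using cycle_value_spread[OF levels.D_less levels.spread_balanced[OF assms(2,3)]] assms(1)
    kemeny_diff_eq by (simp add: S_spread)

end

lemma kemeny_diffs_ge: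
  assumes "x \<in> kemeny_diffs n"
  obtains c where "3 \<le> c" "c \<le> n" "cycle_value n c \<le> x * (6 * real n * (real n - 1))"
proof -
  obtain T u v where T: "x = kemeny n (add_edge T u v) - kemeny n T"
    "is_tree n T" "u < n" "v < n" "u \<noteq> v" "\<not> T u v"
    using assms by (auto simp: kemeny_diffs_def)
  then interpret tree_chord n T u v by unfold_locales
  show ?thesis
    using that[of "Suc D"] D_ge_2 levels.D_less kemeny_diff_lower T(1) by simp
qed

text \<open>The extremal tree: the path \<open>0, \<dots>, d\<close> with the remaining vertices attached as leaves
  to its two ends.\<close>

definition dumbbell_parent :: "nat \<Rightarrow> nat \<Rightarrow> nat \<Rightarrow> nat" where
  "dumbbell_parent n d x = (if x \<le> d then x - 1 else if x \<le> d + (n - Suc d) div 2 then 0 else d)"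

definition dumbbell :: "nat \<Rightarrow> nat \<Rightarrow> nat \<Rightarrow> nat \<Rightarrow> bool" where
  "dumbbell n d i j \<longleftrightarrow>
    (0 < j \<and> j < n \<and> i = dumbbell_parent n d j) \<or> (0 < i \<and> i < n \<and> j = dumbbell_parent n d i)"

lemma dumbbell_parent_less: "0 < x \<Longrightarrow> dumbbell_parent n d x < x"
  by (auto simp: dumbbell_parent_def)

text \<open>Parents carry smaller numbers: following them leads to 0, and every edge is recorded
  exactly once by its larger end.\<close>

lemma dumbbell_tree:
  assumes "n > 0"
  shows "is_tree n (dumbbell n d)"
proof -
  let ?T = "dumbbell n d" and ?p = "dumbbell_parent n d"
  have sym: "?T j i" if "?T i j" for i j using that by (auto simp: dumbbell_def)
  have edge: "(0 < j \<and> j < n \<and> i = ?p j \<and> i < j) \<or> (0 < i \<and> i < n \<and> j = ?p i \<and> j < i)"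
    if "?T i j" for i j
    using that dumbbell_parent_less by (auto simp: dumbbell_def)
  have "i < n \<and> j < n \<and> i \<noteq> j \<and> ?T j i" if "?T i j" for i j
    using edge[OF that] sym[OF that] by auto
  then have "simple_graph n ?T" unfolding simple_graph_def by blast
  moreover have "connected_graph n ?T"
  proof -
    have to0: "?T\<^sup>*\<^sup>* x 0" if "x < n" for x
      using that
    proof (induction x rule: less_induct)
      case (less x)
      show ?case
      proof (cases "x = 0")
        case False
        then have "?T x (?p x)" "?p x < x"
          using less.prems dumbbell_parent_less by (auto simp: dumbbell_def)
        then show ?thesis using less.IH[of "?p x"] less.prems by (auto intro: converse_rtranclp_into_rtranclp)
      qed simp
    qed
    have symp: "symp ?T" using sym by (rule sympI)
    have "?T\<^sup>*\<^sup>* i j" if "i < n" "j < n" for i j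
      using rtranclp_trans[OF to0[OF that(1)] sympD[OF symp_rtranclp[OF symp] to0[OF that(2)]]] .
    then show ?thesis unfolding connected_graph_def using assms by auto
  qed
  moreover have "num_edges n ?T = n - 1"
  proof -
    have "{(i, j). i < j \<and> j < n \<and> ?T i j} = (\<lambda>j. (?p j, j)) ` {1..<n}" (is "?L = ?R")
    proof
      show "?L \<subseteq> ?R"
      proof clarify
        fix i j assume "i < j" "j < n" "?T i j"
        then have "i = ?p j" using edge[of i j] by auto
        then show "(i, j) \<in> ?R" using \<open>i < j\<close> \<open>j < n\<close> by (intro image_eqI[of _ _ j]) auto
      qed
      show "?R \<subseteq> ?L" using dumbbell_parent_less[of _ n d] by (auto simp: dumbbell_def)
    qed
    moreover have "inj_on (\<lambda>j. (?p j, j)) {1..<n}" by (auto intro: inj_onI)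
    ultimately show ?thesis by (simp add: num_edges_def card_image)
  qed
  ultimately show ?thesis by (simp add: is_tree_def)
qed

text \<open>The new edge joins \<open>d\<close>, in the role of \<open>u\<close>, to 0, in the role
  of \<open>v\<close>. Distances to both are given in closed form and certified by
  \<open>gdist_eqI\<close>.\<close>

lemma kemeny_diffs_attained:
  assumes "2 \<le> d" "Suc d \<le> n"
  obtains x where "x \<in> kemeny_diffs n" "x * (6 * real n * (real n - 1)) = cycle_value n (Suc d)"
proof -
  let ?T = "dumbbell n d" and ?p = "dumbbell_parent n d" and ?A = "(n - Suc d) div 2"
  have tree: "is_tree n ?T" using assms by (intro dumbbell_tree) simp
  have chord: "\<not> ?T d 0" using assms by (simp add: dumbbell_def dumbbell_parent_def)
  interpret tree_chord n ?T d 0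
    using tree chord assms by unfold_locales auto
  have par: "?T x (?p x)" if "0 < x" "x < n" for x using that by (simp add: dumbbell_def)
  have d0: "gdist ?T x 0 = (if x \<le> d then x else if x \<le> d + ?A then 1 else Suc d)" (is "_ = ?\<phi> x")
    if "x < n" for x
  proof (rule gdist_eqI[OF v _ _ _ that])
    show "?\<phi> x \<le> Suc (?\<phi> y)" if "?T x y" for x y
      using that assms unfolding dumbbell_def dumbbell_parent_def by (auto split: if_splits)
    show "\<exists>y. ?T x y \<and> ?\<phi> x = Suc (?\<phi> y)" if "x < n" "x \<noteq> 0" for x
      using par[of x] that assms by (intro exI[of _ "?p x"]) (auto simp: dumbbell_parent_def)
  qed simp
  have dd: "gdist ?T x d = (if x \<le> d then d - x else if x \<le> d + ?A then Suc d else 1)" (is "_ = ?\<psi> x")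
    if "x < n" for x
  proof (rule gdist_eqI[OF u _ _ _ that])
    show "?\<psi> x \<le> Suc (?\<psi> y)" if "?T x y" for x y
      using that assms unfolding dumbbell_def dumbbell_parent_def by (auto split: if_splits)
    show "\<exists>y. ?T x y \<and> ?\<psi> x = Suc (?\<psi> y)" if "x < n" "x \<noteq> d" for x
    proof (cases "x < d")
      \<comment> \<open>Below \<open>d\<close> the step towards \<open>d\<close> leads to the child
        \<open>Suc x\<close>; elsewhere it leads to the parent.\<close>
      case True
      then have "?T x (Suc x)" using assms by (simp add: dumbbell_def dumbbell_parent_def)
      then show ?thesis using True by (intro exI[of _ "Suc x"]) auto
    next
      case False
      then show ?thesis using par[of x] that assms by (intro exI[of _ "?p x"]) (auto simp: dumbbell_parent_def)
    qed
  qed simp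
  have D: "D = d" unfolding D_def using d0[of d] assms by simp
  have path: "base x = x \<and> ht x = 0" if "x \<le> d" for x
    using base_eqI[of x 0 x] d0[of x] dd[of x] that assms D by simp
  have left: "base x = 0 \<and> ht x = 1" if "d < x" "x \<le> d + ?A" "x < n" for x
    using base_eqI[of x 1 0] d0[of x] dd[of x] that assms D by simp
  have right: "base x = d \<and> ht x = 1" if "d + ?A < x" "x < n" for x
    using base_eqI[of x 1 d] d0[of x] dd[of x] that assms D by simp
  have "(kemeny n G - kemeny n ?T) * (6 * real n * (real n - 1)) = cycle_value n (Suc D)"
  proof (rule kemeny_diff_balanced)
    show "ht x \<le> 1" if "x < n" for x
      using path[of x] left[of x] right[of x] that by (cases "x \<le> d"; cases "x \<le> d + ?A") auto
    show "base x = (if x \<le> D + (n - Suc D) div 2 then 0 else D)" if "x < n" "x > D" for x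
      using left[of x] right[of x] that D by (cases "x \<le> d + ?A") auto
    show "base x = x" if "x \<le> D" for x using path that D by simp
  qed
  moreover have "kemeny n G - kemeny n ?T \<in> kemeny_diffs n"
    unfolding kemeny_diffs_def using tree chord u v uv by blast
  ultimately show ?thesis using that D by metis
qed

section \<open>The optimal cycle length\<close>

text \<open>Steps have length 2 because each of the two functions matters for one parity of
  \<open>c\<close> only. Nothing is demanded of a step that straddles \<open>a\<close>, hence two
  candidates for each parity.\<close>

definition unimodal_at :: "real \<Rightarrow> (real \<Rightarrow> real) \<Rightarrow> bool" where
  "unimodal_at a g \<longleftrightarrow> (\<forall>c. 3 \<le> c \<longrightarrow> c + 2 \<le> a \<longrightarrow> g (c + 2) \<le> g c) \<and> (\<forall>c. a \<le> c \<longrightarrow> g c \<le> g (c + 2))"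

section \<open>Monotonicity of \<open>f_e\<close> and \<open>f_o\<close> along steps of length
  2\<close>

lemma f_e_step:
  assumes "c > 0"
  shows "f_e n (c + 2) - f_e n c = 6 * (c + 1)\<^sup>2 + 4 * (2 * (real n)\<^sup>2 - 2 * real n - 3) * (c + 1)
    - 6 * real n ^ 3 + 6 * real n + 6 * (real n)\<^sup>2 * (real n - 1) / (c * (c + 2))"
proof -
  define m where "m = real n"
  have "(-3*m^3 + 3*m^2) / (c + 2) - (-3*m^3 + 3*m^2) / c = 6 * m\<^sup>2 * (m - 1) / (c * (c + 2))"
    using assms by (simp add: field_simps power2_eq_square power3_eq_cube)
  then show ?thesis
    unfolding f_e_def Let_def m_def[symmetric]
    by (simp add: power2_eq_square power3_eq_cube algebra_simps)
qed

lemma f_o_step: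
  assumes "c > 0"
  shows "f_o n (c + 2) - f_o n c = f_e n (c + 2) - f_e n c + 6 * real n - 6 * (real n - 1) / (c * (c + 2))"
proof -
  define m where "m = real n"
  have f_o: "f_o n c = f_e n c + 3 * m * c - 6 * m + 3 + (3 * m - 3) / c" for c
    unfolding f_e_def f_o_def Let_def m_def[symmetric] add_divide_distrib diff_divide_distrib
    by (simp add: algebra_simps)
  have "(3 * m - 3) / c - (3 * m - 3) / (c + 2) = 6 * (m - 1) / (c * (c + 2))"
    using assms by (simp add: field_simps)
  moreover have "3 * m * (c + 2) = 3 * m * c + 6 * m" by (simp add: algebra_simps)
  ultimately show ?thesis using f_o[of c] f_o[of "c + 2"] unfolding m_def[symmetric] by linarith
qed

text \<open>The last \<open>6 * m\<close> lets one estimate cover both functions, since the other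
  correction in \<open>f_o_step\<close> is negative. The polynomial part grows with \<open>c\<close>
  while the fraction shrinks, so small and large \<open>c\<close> are treated separately.\<close>

lemma f_step_neg:
  fixes m c :: real
  assumes m: "m \<ge> 23" and c: "3 \<le> c" "c + 2 \<le> 3 * m / 4 + 21 / 64"
  shows "6 * (c + 1)\<^sup>2 + 4 * (2 * m\<^sup>2 - 2 * m - 3) * (c + 1) - 6 * m ^ 3 + 6 * m
    + 6 * m\<^sup>2 * (m - 1) / (c * (c + 2)) + 6 * m \<le> 0"
proof -
  define A where "A = 2 * m\<^sup>2 - 2 * m - 3"
  have m2: "23 * m \<le> m\<^sup>2" using m by (simp add: power2_eq_square)
  have m3: "23 * m\<^sup>2 \<le> m ^ 3" using m by (simp add: power3_eq_cube power2_eq_square)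
  have A: "0 \<le> A" "A \<le> 2 * m\<^sup>2" using m m2 by (auto simp: A_def)
  have mono: "6 * (c + 1)\<^sup>2 + 4 * A * (c + 1) \<le> 6 * X\<^sup>2 + 4 * A * X" if "c + 1 \<le> X" for X
    using that c A by (intro add_mono mult_left_mono power_mono) auto
  show ?thesis
  proof (cases "c \<le> m / 2")
    case True
    \<comment> \<open>For small \<open>c\<close> the value at \<open>c = 3\<close> is enough: the
      fraction costs at most \<open>2 / 5\<close> of \<open>m ^ 3\<close>, and the polynomial about
      4 of the available 6.\<close>
    have "15 \<le> c * (c + 2)" using mult_mono[of 3 c 5 "c + 2"] c by simp
    then have "6 * m\<^sup>2 * (m - 1) / (c * (c + 2)) \<le> 6 * m\<^sup>2 * (m - 1) / 15"
      using m by (intro divide_left_mono) auto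
    also have "\<dots> \<le> 2 * m ^ 3 / 5" using m by (simp add: power2_eq_square power3_eq_cube field_simps)
    finally have q: "6 * m\<^sup>2 * (m - 1) / (c * (c + 2)) \<le> 2 * m ^ 3 / 5" .
    have "4 * A * (m / 2 + 1) \<le> 4 * (2 * m\<^sup>2) * (m / 2 + 1)"
      using A m by (intro mult_right_mono) auto
    also have "\<dots> = 4 * m ^ 3 + 8 * m\<^sup>2" by (simp add: power2_eq_square power3_eq_cube algebra_simps)
    finally have "6 * (c + 1)\<^sup>2 + 4 * A * (c + 1) \<le> 6 * (m / 2 + 1)\<^sup>2 + (4 * m ^ 3 + 8 * m\<^sup>2)"
      using mono[of "m / 2 + 1"] True by linarith
    moreover have "6 * (m / 2 + 1)\<^sup>2 = 3 * m\<^sup>2 / 2 + 6 * m + 6"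
      by (simp add: power2_eq_square algebra_simps)
    ultimately show ?thesis using q m m2 m3 unfolding A_def[symmetric] by linarith
  next
    case False
    have "m / 2 * (m / 2) \<le> c * (c + 2)" using False m by (intro mult_mono) auto
    then have "6 * m\<^sup>2 * (m - 1) / (c * (c + 2)) \<le> 6 * m\<^sup>2 * (m - 1) / (m / 2 * (m / 2))"
      using m c by (intro divide_left_mono mult_nonneg_nonneg mult_pos_pos) auto
    also have "\<dots> = 24 * (m - 1)" using m by (simp add: power2_eq_square field_simps)
    finally have q: "6 * m\<^sup>2 * (m - 1) / (c * (c + 2)) \<le> 24 * (m - 1)" .
    \<comment> \<open>The largest possible \<open>c + 1\<close>, as
      \<open>43 / 64 = 1 - 21 / 64\<close>. There the cubic terms cancel and
      \<open>- 8 * m\<^sup>2\<close> dominates.\<close>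
    have "6 * (c + 1)\<^sup>2 + 4 * A * (c + 1) \<le> 6 * (3 * m / 4 - 43 / 64)\<^sup>2 + 4 * A * (3 * m / 4 - 43 / 64)"
      using mono c by simp
    also have "\<dots> = 6 * m ^ 3 - 8 * m\<^sup>2 - 619 / 64 * m + 22059 / 2048"
      unfolding A_def by (simp add: power2_eq_square power3_eq_cube field_simps)
    finally have p: "6 * (c + 1)\<^sup>2 + 4 * A * (c + 1) \<le> 6 * m ^ 3 - 8 * m\<^sup>2 - 619 / 64 * m + 22059 / 2048" .
    have "24 * (m - 1) - 8 * m\<^sup>2 - 619 / 64 * m + 22059 / 2048 + 12 * m \<le> 0"
      using m m2 by (simp add: field_simps)
    then show ?thesis using p q unfolding A_def[symmetric] by linarith
  qed
qed

text \<open>The square and the positive fraction are given up. At the least \<open>c + 1\<close>,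
  where \<open>85 / 64 = 1 + 21 / 64\<close>, the cubic terms cancel and a positive quadratic term
  remains.\<close>

lemma f_step_pos:
  fixes m c :: real
  assumes m: "m \<ge> 23" and c: "3 * m / 4 + 21 / 64 \<le> c"
  shows "0 \<le> 6 * (c + 1)\<^sup>2 + 4 * (2 * m\<^sup>2 - 2 * m - 3) * (c + 1) - 6 * m ^ 3 + 6 * m"
proof -
  have m2: "23 * m \<le> m\<^sup>2" using m by (simp add: power2_eq_square)
  have "4 * (2 * m\<^sup>2 - 2 * m - 3) * (3 * m / 4 + 85 / 64) \<le> 4 * (2 * m\<^sup>2 - 2 * m - 3) * (c + 1)"
    using m m2 c by (intro mult_left_mono) auto
  moreover have "4 * (2 * m\<^sup>2 - 2 * m - 3) * (3 * m / 4 + 85 / 64) =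
      6 * m ^ 3 + 37 / 8 * m\<^sup>2 - 157 / 8 * m - 255 / 16"
    by (simp add: power2_eq_square power3_eq_cube field_simps)
  ultimately show ?thesis using m m2 zero_le_power2[of "c + 1"] by linarith
qed

lemma unimodal_f:
  assumes "n \<ge> 23"
  shows "unimodal_at (c_star n) (f_e n)" "unimodal_at (c_star n) (f_o n)"
proof -
  define m where "m = real n"
  have m: "m \<ge> 23" using assms by (simp add: m_def)
  have "f_e n (c + 2) \<le> f_e n c \<and> f_o n (c + 2) \<le> f_o n c" if "3 \<le> c" "c + 2 \<le> c_star n" for c
  proof -
    have "0 \<le> 6 * (m - 1) / (c * (c + 2))" using that m by simp
    then show ?thesis
      using f_step_neg[OF m, of c] f_e_step[of c n] f_o_step[of c n] that m
      unfolding c_star_def m_def[symmetric] by linarith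
  qed
  moreover have "f_e n c \<le> f_e n (c + 2) \<and> f_o n c \<le> f_o n (c + 2)" if "c_star n \<le> c" for c
  proof -
    have c: "c > 0" using that m by (simp add: c_star_def m_def)
    \<comment> \<open>The negative fraction in \<open>f_o_step\<close> is absorbed by the positive
      one in \<open>f_e_step\<close>.\<close>
    have "6 * (m - 1) / (c * (c + 2)) \<le> 6 * m\<^sup>2 * (m - 1) / (c * (c + 2))"
      using c m power_mono[of 1 m 2] by (intro divide_right_mono mult_right_mono) auto
    moreover have "0 \<le> 6 * (m - 1) / (c * (c + 2))" using c m by simp
    ultimately show ?thesis
      using f_step_pos[OF m, of c] f_e_step[of c n] f_o_step[of c n] that c m
      unfolding c_star_def m_def[symmetric] by linarith
  qed
  ultimately show "unimodal_at (c_star n) (f_e n)" "unimodal_at (c_star n) (f_o n)"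
    unfolding unimodal_at_def by blast+
qed

section \<open>Locating the minimum among four candidates\<close>

lemma unimodal_descent:
  assumes "unimodal_at a g" "3 \<le> c" "real (c + 2 * k) \<le> a"
  shows "g (real (c + 2 * k)) \<le> g (real c)"
  using assms(3)
proof (induction k)
  case (Suc k)
  have "g (real (c + 2 * k) + 2) \<le> g (real (c + 2 * k))"
    using assms(1,2) Suc.prems unfolding unimodal_at_def by auto
  then show ?case using Suc by (simp add: add.commute add.left_commute)
qed simp

lemma unimodal_ascent:
  assumes "unimodal_at a g" "a \<le> real c"
  shows "g (real c) \<le> g (real (c + 2 * k))"
proof (induction k)
  case (Suc k)
  have "g (real (c + 2 * k)) \<le> g (real (c + 2 * k) + 2)"
    using assms unfolding unimodal_at_def by auto
  then show ?case using Suc by (simp add: add.commute add.left_commute)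
qed simp

text \<open>As \<open>a\<close> lies between \<open>F\<close> and \<open>F + 1\<close>, the points
  next to it are \<open>F\<close> and \<open>F + 2\<close> in the parity of \<open>F\<close>, and
  \<open>F - 1\<close> and \<open>F + 1\<close> in the other. Every other \<open>c\<close> reaches
  one of these by steps of length 2 on one side of \<open>a\<close>. The bounds on \<open>F\<close>
  keep all four between 3 and \<open>n\<close>.\<close>

lemma unimodal_parity_min:
  assumes g: "unimodal_at a g" and h: "unimodal_at a h"
    and F: "real F \<le> a" "a < real F + 1" "4 \<le> F" "F + 2 \<le> n"
  defines "val \<equiv> \<lambda>c. if even (F + c) then g (real c) else h (real c)"
    and "M \<equiv> Min {g (real F), g (real F + 2), h (real F + 1), h (real F - 1)}"
  shows "\<And>c. 3 \<le> c \<Longrightarrow> M \<le> val c" and "\<exists>c. 3 \<le> c \<and> c \<le> n \<and> val c = M"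
proof -
  have M: "M \<le> g (real F)" "M \<le> g (real F + 2)" "M \<le> h (real F + 1)" "M \<le> h (real F - 1)"
    unfolding M_def by auto
  show "M \<le> val c" if c: "3 \<le> c" for c
  proof (cases "even (F + c)")
    case True
    show ?thesis
    proof (cases "c \<le> F")
      case le: True
      have "even (F - c)" using True le by simp
      then obtain k where "F - c = 2 * k" by blast
      then have "F = c + 2 * k" using le by simp
      then show ?thesis using unimodal_descent[OF g c, of k] F(1) M(1) True by (simp add: val_def)
    next
      case False
      have "even (c - (F + 2))" "F + 2 \<le> c" using True False by presburger+
      then obtain k where k: "c = F + 2 + 2 * k" by (metis dvdE le_add_diff_inverse)
      have "g (real (F + 2)) \<le> g (real c)" unfolding k using F(2) by (intro unimodal_ascent[OF g]) simp
      then show ?thesis using M(2) True by (simp add: val_def add.commute)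
    qed
  next
    case odd: False
    show ?thesis
    proof (cases "c < F")
      case True
      have "even (F - 1 - c)" "c \<le> F - 1" using odd True by presburger+
      then obtain k where "F - 1 - c = 2 * k" by blast
      then have k: "F - 1 = c + 2 * k" using \<open>c \<le> F - 1\<close> by simp
      have "h (real (F - 1)) \<le> h (real c)"
        unfolding k using F k by (intro unimodal_descent[OF h c]) linarith
      then show ?thesis using M(4) odd F(3) by (simp add: val_def of_nat_diff)
    next
      case False
      have "even (c - (F + 1))" "F + 1 \<le> c" using odd False by presburger+
      then obtain k where k: "c = F + 1 + 2 * k" by (metis dvdE le_add_diff_inverse)
      have "h (real (F + 1)) \<le> h (real c)" unfolding k using F(2) by (intro unimodal_ascent[OF h]) simp
      then show ?thesis using M(3) odd by (simp add: val_def add.commute)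
    qed
  qed
  have "M \<in> {g (real F), g (real F + 2), h (real F + 1), h (real F - 1)}"
    unfolding M_def by (rule Min_in) auto
  moreover have "val F = g (real F)" "val (F + 2) = g (real F + 2)" "val (F + 1) = h (real F + 1)"
    "val (F - 1) = h (real F - 1)"
    using F(3) by (auto simp: val_def of_nat_diff add.commute)
  ultimately have "M \<in> {val F, val (F + 2), val (F + 1), val (F - 1)}" by simp
  then show "\<exists>c. 3 \<le> c \<and> c \<le> n \<and> val c = M"
    using F(3,4) by (elim insertE) (force intro: exI[of _ F] exI[of _ "F + 2"] exI[of _ "F + 1"] exI[of _ "F - 1"])+
qed

lemma c_star_floor:
  assumes "n \<ge> 23"
  obtains F where "\<lfloor>c_star n\<rfloor> = int F" "\<lceil>c_star n\<rceil> = int F + 1" "real F \<le> c_star n" "c_star n < real F + 1"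
    "4 \<le> F" "F + 2 \<le> n" "even (n + F) \<longleftrightarrow> n mod 8 \<in> {0, 1, 6, 7}"
proof -
  \<comment> \<open>\<open>c_star n = (48 * n + 21) / 64\<close>. The numerator is odd, so this is
    never an integer and the ceiling is the floor plus 1.\<close>
  define F where "F = (48 * n + 21) div 64"
  have F: "64 * F < 48 * n + 21" "48 * n + 21 < 64 * F + 64"
  proof -
    have "64 * F + (48 * n + 21) mod 64 = 48 * n + 21" unfolding F_def by (rule mult_div_mod_eq)
    moreover have "64 * F \<noteq> 48 * n + 21" by presburger
    moreover have "(48 * n + 21) mod 64 < 64" by simp
    ultimately show "64 * F < 48 * n + 21" "48 * n + 21 < 64 * F + 64" by linarith+
  qed
  have "real (64 * F) < real (48 * n + 21)" "real (48 * n + 21) < real (64 * F + 64)"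
    using F by (simp_all only: of_nat_less_iff)
  then have r: "real F < c_star n" "c_star n < real F + 1" by (simp_all add: c_star_def)
  have fl: "\<lfloor>c_star n\<rfloor> = int F" using r by (intro floor_unique) auto
  have ce: "\<lceil>c_star n\<rceil> = int F + 1" using r by (intro ceiling_unique) auto
  have "even (n + F) \<longleftrightarrow> n mod 8 \<in> {0, 1, 6, 7}"
  proof -
    \<comment> \<open>Raising \<open>n\<close> by 8 raises \<open>F\<close> by 6, so the parity of
      \<open>n + F\<close> depends only on \<open>n mod 8\<close>.\<close>
    define q r where "q = n div 8" and "r = n mod 8"
    have n: "n = 8 * q + r" "r < 8" by (simp_all add: q_def r_def)
    have "F = (48 * r + 21 + 64 * (6 * q)) div 64" by (simp add: F_def n(1) algebra_simps)
    also have "\<dots> = 6 * q + (48 * r + 21) div 64" by (subst div_mult_self2) auto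
    finally have F: "F = 6 * q + (48 * r + 21) div 64" .
    have "r = 0 \<or> r = 1 \<or> r = 2 \<or> r = 3 \<or> r = 4 \<or> r = 5 \<or> r = 6 \<or> r = 7"
      using n(2) by linarith
    then show ?thesis unfolding r_def[symmetric] unfolding F n(1) by (elim disjE) simp_all
  qed
  moreover have "4 \<le> F" "F + 2 \<le> n" using F assms by linarith+
  ultimately show ?thesis using that[of F] fl ce r by simp
qed

theorem theorem4p2:
  fixes n :: nat
  assumes "n \<ge> 23"
  shows "(n mod 8 \<in> {0, 1, 6, 7} \<longrightarrow>
           (let v = (1 / (6 * real n * (real n - 1))) *
                 Min {f_e n (of_int \<lfloor>c_star n\<rfloor>), f_e n (of_int \<lfloor>c_star n\<rfloor> + 2),
                      f_o n (of_int \<lceil>c_star n\<rceil>), f_o n (of_int \<lceil>c_star n\<rceil> - 2)}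
            in v \<in> kemeny_diffs n \<and> (\<forall>x\<in>kemeny_diffs n. v \<le> x))) \<and>
         (n mod 8 \<in> {2, 3, 4, 5} \<longrightarrow>
           (let v = (1 / (6 * real n * (real n - 1))) *
                 Min {f_o n (of_int \<lfloor>c_star n\<rfloor>), f_o n (of_int \<lfloor>c_star n\<rfloor> + 2),
                      f_e n (of_int \<lceil>c_star n\<rceil>), f_e n (of_int \<lceil>c_star n\<rceil> - 2)}
            in v \<in> kemeny_diffs n \<and> (\<forall>x\<in>kemeny_diffs n. v \<le> x)))"
proof -
  have pos: "6 * real n * (real n - 1) > 0" using assms by simp
  have minimum: "let v = (1 / (6 * real n * (real n - 1))) * M
      in v \<in> kemeny_diffs n \<and> (\<forall>x\<in>kemeny_diffs n. v \<le> x)"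
    if le: "\<And>c. 3 \<le> c \<Longrightarrow> M \<le> cycle_value n c" and ex: "\<exists>c. 3 \<le> c \<and> c \<le> n \<and> cycle_value n c = M"
    for M
  proof -
    define v where "v = (1 / (6 * real n * (real n - 1))) * M"
    have v: "v * (6 * real n * (real n - 1)) = M" using assms by (auto simp: v_def)
    obtain c where c: "3 \<le> c" "c \<le> n" "cycle_value n c = M" using ex by blast
    define d where "d = c - 1"
    have d: "2 \<le> d" "Suc d \<le> n" "c = Suc d" using c by (auto simp: d_def)
    obtain x where x: "x \<in> kemeny_diffs n" "x * (6 * real n * (real n - 1)) = cycle_value n c"
      using kemeny_diffs_attained[OF d(1,2)] unfolding d(3) .
    then have "x * (6 * real n * (real n - 1)) = v * (6 * real n * (real n - 1))" using c v by simp
    then have "x = v" using pos by (simp only: mult_right_cancel[OF less_imp_neq[OF pos, symmetric]])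
    moreover have "v \<le> y" if "y \<in> kemeny_diffs n" for y
    proof -
      obtain c where "3 \<le> c" "cycle_value n c \<le> y * (6 * real n * (real n - 1))"
        using kemeny_diffs_ge \<open>y \<in> kemeny_diffs n\<close> by metis
      then have "v * (6 * real n * (real n - 1)) \<le> y * (6 * real n * (real n - 1))"
        using le[of c] v by linarith
      then show ?thesis using pos by (rule mult_right_le_imp_le)
    qed
    ultimately show ?thesis unfolding Let_def v_def[symmetric] using x(1) by blast
  qed
  obtain F where F: "\<lfloor>c_star n\<rfloor> = int F" "\<lceil>c_star n\<rceil> = int F + 1"
    and a: "real F \<le> c_star n" "c_star n < real F + 1" "4 \<le> F" "F + 2 \<le> n"
    and par: "even (n + F) \<longleftrightarrow> n mod 8 \<in> {0, 1, 6, 7}"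
    using c_star_floor[OF assms] by metis
  have cast: "real_of_int (int F) = real F" "real_of_int (int F + 1) = real F + 1" "real F + 1 - 2 = real F - 1"
    by simp_all
  note e = unimodal_f(1)[OF assms] and o = unimodal_f(2)[OF assms]
  show ?thesis
  proof (intro conjI impI)
    assume "n mod 8 \<in> {0, 1, 6, 7}"
    then have "even (n + F)" using par by simp
    \<comment> \<open>The parity of \<open>F\<close> relative to \<open>n\<close> decides which of
      the two functions belongs to the floor.\<close>
    then have "even (n + c) \<longleftrightarrow> even (F + c)" for c by presburger
    then show "let v = (1 / (6 * real n * (real n - 1))) *
                 Min {f_e n (of_int \<lfloor>c_star n\<rfloor>), f_e n (of_int \<lfloor>c_star n\<rfloor> + 2),
                      f_o n (of_int \<lceil>c_star n\<rceil>), f_o n (of_int \<lceil>c_star n\<rceil> - 2)}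
            in v \<in> kemeny_diffs n \<and> (\<forall>x\<in>kemeny_diffs n. v \<le> x)"
      unfolding F cast using unimodal_parity_min[OF e o a] by (intro minimum) (simp_all only: cycle_value_def)
  next
    assume "n mod 8 \<in> {2, 3, 4, 5}"
    then have "odd (n + F)" using par by auto
    then have "even (n + c) \<longleftrightarrow> \<not> even (F + c)" for c by presburger
    then have "cycle_value n c = (if even (F + c) then f_o n (real c) else f_e n (real c))" for c
      by (simp add: cycle_value_def)
    then show "let v = (1 / (6 * real n * (real n - 1))) *
                 Min {f_o n (of_int \<lfloor>c_star n\<rfloor>), f_o n (of_int \<lfloor>c_star n\<rfloor> + 2),
                      f_e n (of_int \<lceil>c_star n\<rceil>), f_e n (of_int \<lceil>c_star n\<rceil> - 2)}
            in v \<in> kemeny_diffs n \<and> (\<forall>x\<in>kemeny_diffs n. v \<le> x)"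
      unfolding F cast using unimodal_parity_min[OF o e a] by (intro minimum) (simp_all only:)
  qed
qed

end
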